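(* For real $\nu>-1$ let $f_\nu:\mathbb{D}\to\mathbb{C}$ be the normalized Bessel function $$f_{\nu}(z)=2^{\nu}\Gamma(\nu+1)z^{1-\frac{\nu}{2}}J_{\nu}(\sqrt{z})=\sum_{n\geq0}\frac{(-1)^n\Gamma(\nu+1)z^{n+1}}{4^n\,n!\,\Gamma(\nu+n+1)}.$$ The following assertions are true: (a) The function $f_{\nu}$ is starlike in $\mathbb{D}$ and all of its derivatives are close-to-convex in $\mathbb{D}$ if and only if $\nu\geq\nu_0$, where $\nu_0\simeq-0.5623\dots$ is the unique root of the equation $f'_{\nu}(1)=0$ (in the unknown $\nu$) on $(-1,\infty)$. (b) The function $f_{\nu}$ and all of its derivatives are convex in $\mathbb{D}$ if and only if $\nu\geq\nu_1$, where $\nu_1\simeq-0.1438\dots$ is the unique root of the equation $3J_{\nu}(1)+2(\nu-2)J_{\nu+1}(1)=0$ (in the unknown $\nu$) on $(-1,\infty)$.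
   Context: $\mathbb{D}=\{z\in\mathbb{C}:|z|<1\}$ is the open unit disk. $J_\nu$ is the Bessel function of the first kind, $J_\nu(z)=\sum_{n\ge 0}\frac{(-1)^n}{n!\,\Gamma(\nu+n+1)}\left(\frac z2\right)^{2n+\nu}$. The power series defining $f_\nu$ converges on all of $\mathbb{C}$, so $f_\nu$ extends to an entire function, and $f_\nu'(1)$ denotes the derivative in $z$ of this extension at $z=1$. "All of its derivatives" means $f_\nu^{(k)}$ for all integers $k\ge 1$. The terms are used in the usual sense of geometric function theory, without requiring the derivatives to be normalized: a function analytic in $\mathbb{D}$ and vanishing at $0$ is starlike if it is univalent and its image is starlike with respect to $0$; an analytic function is convex if it is univalent in $\mathbb{D}$ and its image is a convex domain; an analytic function $g$ is close-to-convex in $\mathbb{D}$ if there is a convex univalent function $\phi$ on $\mathbb{D}$ with $\mathrm{Re}\,(g'(z)/\phi'(z))>0$ for all $z\in\mathbb{D}$. *)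

theory Defs
  imports "HOL-Complex_Analysis.Complex_Analysis"
begin

text \<open>
  The Bessel function of the first kind, with the principal branch of the power. Since
  \<open>0 powr a = 0\<close> for every \<open>a\<close>, including \<open>a = 0\<close>, the value \<open>J\<^sub>0(0) = 1\<close> has to be set separately.
\<close>

definition Bessel_J :: "real \<Rightarrow> complex \<Rightarrow> complex" where
  "Bessel_J \<nu> z =
     (if \<nu> = 0 \<and> z = 0 then 1
      else (\<Sum>n. (-1) ^ n / (fact n * Gamma (of_real \<nu> + of_nat n + 1))
                  * (z / 2) powr (of_nat (2 * n) + of_real \<nu>)))"

text \<open>
  The normalized Bessel function, defined on the whole plane by its power series; the lemma
  \<open>normalized_Bessel_eq_Bessel_J\<close> below gives the closed form in terms of \<open>Bessel_J\<close>.
\<close>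

definition normalized_Bessel :: "real \<Rightarrow> complex \<Rightarrow> complex" where
  "normalized_Bessel \<nu> z =
     (\<Sum>n. (-1) ^ n * Gamma (of_real \<nu> + 1) * z ^ (n + 1)
            / (4 ^ n * fact n * Gamma (of_real \<nu> + of_nat n + 1)))"

definition univalent_in_disk :: "(complex \<Rightarrow> complex) \<Rightarrow> bool" where
  "univalent_in_disk g \<longleftrightarrow> g holomorphic_on ball 0 1 \<and> inj_on g (ball 0 1)"

text \<open>
  The library predicate \<^const>\<open>starlike\<close> only asserts starlikeness with respect to some point of
  the set, so starlikeness with respect to the origin is spelled out.
\<close>

definition starlike_in_disk :: "(complex \<Rightarrow> complex) \<Rightarrow> bool" where
  "starlike_in_disk g \<longleftrightarrow>
     univalent_in_disk g \<and> g 0 = 0 \<and> (\<forall>w \<in> g ` ball 0 1. closed_segment 0 w \<subseteq> g ` ball 0 1)"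

definition convex_in_disk :: "(complex \<Rightarrow> complex) \<Rightarrow> bool" where
  "convex_in_disk g \<longleftrightarrow> univalent_in_disk g \<and> convex (g ` ball 0 1)"

definition close_to_convex_in_disk :: "(complex \<Rightarrow> complex) \<Rightarrow> bool" where
  "close_to_convex_in_disk g \<longleftrightarrow>
     g holomorphic_on ball 0 1 \<and>
     (\<exists>\<phi>. convex_in_disk \<phi> \<and> (\<forall>z \<in> ball 0 1. Re (deriv g z / deriv \<phi> z) > 0))"

lemma Bessel_series_summable:
  fixes z :: complex
  assumes "\<nu> > -1"
  shows "summable (\<lambda>n. (-1) ^ n * z ^ n / (4 ^ n * fact n * Gamma (of_real \<nu> + of_nat n + 1)))"
    (is "summable ?b")
proof -
  obtain N :: nat where N: "real N > max (cmod z) (1 - \<nu>)"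
    using reals_Archimedean2 by blast
  show ?thesis
  proof (rule summable_ratio_test[of "1/2" N])
    fix n assume n: "n \<ge> N"
    define a :: complex where "a = of_real (\<nu> + real n + 1)"
    have a: "complex_of_real \<nu> + of_nat n + 1 = a"
      by (simp add: a_def)
    have norm_a: "cmod a = \<nu> + real n + 1"
      using assms unfolding a_def norm_of_real by simp
    have a': "a \<notin> \<int>\<^sub>\<le>\<^sub>0"
    proof
      assume "a \<in> \<int>\<^sub>\<le>\<^sub>0"
      then have "Re a \<le> 0" by (auto elim!: nonpos_Ints_cases)
      then show False using assms by (simp add: a_def)
    qed
    have "of_real \<nu> + of_nat (Suc n) + 1 = a + 1"
      by (simp add: a[symmetric])
    then have G: "Gamma (of_real \<nu> + of_nat (Suc n) + 1) = a * Gamma a"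
      using Gamma_plus1[OF a'] by (simp only:)
    have "?b (Suc n) = ?b n * (- z / (4 * of_nat (Suc n) * a))"
      unfolding G a by (simp add: mult_ac)
    then have "norm (?b (Suc n)) = norm (?b n) * (cmod z / (4 * real (Suc n) * cmod a))"
      by (simp only: norm_mult norm_divide norm_minus_cancel norm_of_nat norm_numeral)
    moreover have "cmod z / (4 * real (Suc n) * cmod a) \<le> 1/2"
    proof -
      have "cmod z \<le> real (Suc n)" "1 \<le> cmod a"
        using N n unfolding norm_a by linarith+
      then have "cmod z * 1 \<le> real (Suc n) * cmod a"
        by (intro mult_mono) auto
      moreover have "0 < real (Suc n) * cmod a"
        using \<open>1 \<le> cmod a\<close> by (intro mult_pos_pos) auto
      ultimately have "cmod z \<le> 1/2 * (4 * real (Suc n) * cmod a)" "0 < 4 * real (Suc n) * cmod a"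
        by linarith+
      then show ?thesis by (simp only: pos_divide_le_eq)
    qed
    ultimately show "norm (?b (Suc n)) \<le> 1/2 * norm (?b n)"
      by (metis mult.commute mult_left_mono norm_ge_zero)
  qed simp
qed

lemma normalized_Bessel_eq_Bessel_J:
  assumes "\<nu> > -1" and "z \<noteq> 0"
  shows "normalized_Bessel \<nu> z =
           2 powr of_real \<nu> * Gamma (of_real \<nu> + 1) * z powr (1 - of_real \<nu> / 2) * Bessel_J \<nu> (csqrt z)"
proof -
  define b where
    "b = (\<lambda>n. (-1) ^ n * z ^ n / (4 ^ n * fact n * Gamma (complex_of_real \<nu> + of_nat n + 1)))"
  define c where "c = (csqrt z / 2) powr complex_of_real \<nu>"
  have b: "summable b" unfolding b_def using Bessel_series_summable[OF assms(1)] .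
  have "normalized_Bessel \<nu> z = (\<Sum>n. Gamma (of_real \<nu> + 1) * z * b n)"
    unfolding normalized_Bessel_def b_def by (simp add: mult_ac)
  also have "\<dots> = Gamma (of_real \<nu> + 1) * z * suminf b"
    by (rule suminf_mult[OF b])
  finally have lhs: "normalized_Bessel \<nu> z = Gamma (of_real \<nu> + 1) * z * suminf b" .
  have pw: "(csqrt z / 2) powr (of_nat (2 * n) + of_real \<nu>) = z ^ n / 4 ^ n * c" for n
  proof -
    have "(csqrt z / 2) powr (of_nat (2 * n) + of_real \<nu>) = (csqrt z / 2) ^ (2 * n) * c"
      using assms(2) unfolding c_def by (simp only: powr_add powr_nat) simp
    also have "(csqrt z / 2) ^ (2 * n) = z ^ n / 4 ^ n"
      by (simp add: power_mult power_divide)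
    finally show ?thesis .
  qed
  have "Bessel_J \<nu> (csqrt z) = (\<Sum>n. c * b n)"
    using assms(2) unfolding Bessel_J_def b_def pw by (simp add: mult_ac)
  also have "\<dots> = c * suminf b"
    by (rule suminf_mult[OF b])
  finally have J: "Bessel_J \<nu> (csqrt z) = c * suminf b" .
  have Ln: "Ln (csqrt z / 2) = Ln z / 2 - Ln 2"
  proof -
    have "csqrt z = exp (Ln z / 2)"
      using assms(2) by (rule csqrt_exp_Ln)
    moreover have "Ln (exp (Ln z / 2)) = Ln z / 2"
      using mpi_less_Im_Ln[OF assms(2)] Im_Ln_le_pi[OF assms(2)] pi_gt_zero
      by (intro Ln_exp) auto
    moreover have "Ln (csqrt z / 2) = Ln (csqrt z) - Ln 2"
      using Ln_divide_of_real[of 2 "csqrt z"] Ln_of_real[of 2] assms(2) by simp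
    ultimately show ?thesis by simp
  qed
  have "2 powr of_real \<nu> * z powr (1 - of_real \<nu> / 2) * c
          = exp (of_real \<nu> * Ln 2 + (1 - of_real \<nu> / 2) * Ln z + of_real \<nu> * (Ln z / 2 - Ln 2))"
    using assms(2) unfolding c_def by (simp add: powr_def Ln exp_add)
  also have "\<dots> = exp (Ln z)"
    by (simp add: algebra_simps)
  finally have "2 powr of_real \<nu> * z powr (1 - of_real \<nu> / 2) * c = z"
    using assms(2) by simp
  then show ?thesis
    unfolding lhs J by (metis (no_types, lifting) mult.assoc mult.commute)
qed

end

theory Submission
  imports Defs
begin

text \<open>
  Let \<open>c = \<nu> + 1 > 0\<close>, let \<open>B\<close> be the series \<open>0F1(; c; - z / 4)\<close> and \<open>f = z B\<close> the normalized Bessel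
  function. Its coefficients are real and alternate in sign, so the critical boundary point is
  \<open>z = 1\<close>, and both thresholds are decided there: \<open>f\<close> is starlike if and only if \<open>f'(1) \<ge> 0\<close>, and
  convex if and only if \<open>(z f')'(1) \<ge> 0\<close>.

  The derivatives of \<open>f\<close> impose no condition. For every \<open>c > 0\<close> the coefficients of \<open>f\<^sup>(\<^sup>k\<^sup>)\<close> with
  \<open>k \<ge> 1\<close> decay so fast that \<open>\<Sum>n\<ge>2. n\<^sup>2 \<bar>p\<^sub>n\<bar> \<le> \<bar>p\<^sub>1\<bar>\<close>, which makes these functions convex
  (\<open>convex_in_disk_coefficient_criterion\<close>, \<open>bessel_higher_derivatives_convex\<close>), and a convex
  function is close-to-convex with respect to itself.

  Sufficiency. The quotient of the series for \<open>c + 1\<close> and \<open>c\<close> has a continued fraction with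
  positive coefficients, and therefore nonnegative Taylor coefficients. From this one reads off that
  \<open>- B' / B\<close> and \<open>- f'' / f'\<close> have nonnegative coefficients (\<open>nonneg_coeffs_bessel_log_deriv\<close>,
  \<open>nonneg_coeffs_bessel_deriv_log_deriv\<close>). So on a circle of radius \<open>r\<close> the real parts of \<open>z f' / f\<close> and
  of \<open>1 + z f'' / f'\<close> are smallest at \<open>r\<close>, where they are quotients of the positive numbers \<open>f'(r)\<close>,
  \<open>B(r)\<close> and \<open>(z f')'(r)\<close>. Univalence comes from \<open>Re f' > 0\<close>: as \<open>f'\<close> is convex with real
  coefficients, \<open>Re (f' z) \<ge> f' (norm z)\<close> by a subordination argument (\<open>convex_symmetric_Re_le\<close>).
  The passage from these inequalities to the geometry of the image is the subject of
  \<open>starlike_in_disk_if_Re_nonneg\<close> and \<open>convex_in_disk_if_Re_nonneg\<close>.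

  Necessity. A univalent \<open>f\<close> has \<open>f' \<noteq> 0\<close> on \<open>[0, 1)\<close>, hence \<open>f'(1) \<ge> 0\<close>. For a convex \<open>f\<close> with real
  coefficients \<open>Re f\<close> is maximal on each circle at the positive real point, and the second derivative
  test gives \<open>(z f')'(r) \<ge> 0\<close> (\<open>convex_symmetric_imp_nonneg\<close>).

  Finally \<open>f'(1)\<close> and \<open>(z f')'(1)\<close> are alternating series in which the term of index 1 dominates the
  later ones even after differences are taken (\<open>weighted_alternating_series\<close>). They are therefore
  strictly increasing in \<open>c\<close>, so each has exactly one root, which six terms of the
  series locate to four decimals (\<open>bessel_sum_numerics\<close>). Bessel's differential equation turns
  \<open>(z f')'(1) = 0\<close> into the stated equation between Bessel functions (\<open>bessel_sum_equation\<close>).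
\<close>

section \<open>Analytic criteria for univalent, convex and starlike maps\<close>

text \<open>
  The converse of the supporting hyperplane theorem for closed sets with interior. If a segment
  between two points of the set left it at \<open>p\<close>, then the segment from an interior point \<open>q\<close> to \<open>p\<close>
  would cross the frontier at a point \<open>b\<close>. The hyperplane through \<open>b\<close> has \<open>q\<close> strictly on one side
  and \<open>p\<close> weakly on the same side, so \<open>b\<close>, which lies between them, cannot be on it.
\<close>

lemma convex_if_supporting_hyperplanes:
  fixes S :: "'a::euclidean_space set"
  assumes "closed S" and "interior S \<noteq> {}"
    and supp: "\<And>b. b \<in> frontier S \<Longrightarrow> \<exists>n. n \<noteq> 0 \<and> (\<forall>v\<in>S. n \<bullet> v \<le> n \<bullet> b)"
  shows "convex S"
proof (rule ccontr)
  assume "\<not> convex S"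
  then obtain x y p where xy: "x \<in> S" "y \<in> S" and p: "p \<in> closed_segment x y" "p \<notin> S"
    unfolding convex_contains_segment by blast
  obtain q where q: "q \<in> interior S" using assms(2) by blast
  have "closed_segment q p \<inter> frontier S \<noteq> {}"
    using q p interior_subset[of S] by (intro connected_Int_frontier) auto
  then obtain b where b: "b \<in> closed_segment q p" "b \<in> frontier S" by blast
  have "b \<in> S" using b(2) assms(1) frontier_subset_closed by blast
  with p have "b \<noteq> p" by blast
  obtain n where n: "n \<noteq> 0" "\<And>v. v \<in> S \<Longrightarrow> n \<bullet> v \<le> n \<bullet> b"
    using supp[OF b(2)] by blast
  obtain e where e: "e > 0" "cball q e \<subseteq> S"
    using q by (meson mem_interior_cball)
  \<comment> \<open>Moving the interior point in the direction of the normal makes the inequality at it strict.\<close>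
  have "q + (e / norm n) *\<^sub>R n \<in> cball q e"
    using e(1) n(1) by (simp add: dist_norm)
  then have "n \<bullet> (q + (e / norm n) *\<^sub>R n) \<le> n \<bullet> b" using e(2) n(2) by blast
  moreover have "(e / norm n) * (n \<bullet> n) > 0" using e(1) n(1) by simp
  ultimately have strict: "n \<bullet> q < n \<bullet> b" by (simp add: inner_add_right)
  obtain t where t: "0 \<le> t" "t \<le> 1" "p = (1 - t) *\<^sub>R x + t *\<^sub>R y"
    using p(1) by (auto simp: in_segment)
  have "n \<bullet> p = (1 - t) * (n \<bullet> x) + t * (n \<bullet> y)"
    using t(3) by (simp add: inner_add_right)
  also have "\<dots> \<le> (1 - t) * (n \<bullet> b) + t * (n \<bullet> b)"
    using t n(2) xy by (intro add_mono mult_left_mono) auto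
  finally have le: "n \<bullet> p \<le> n \<bullet> b" by (simp add: algebra_simps)
  obtain s where s: "0 \<le> s" "s \<le> 1" "b = (1 - s) *\<^sub>R q + s *\<^sub>R p"
    using b(1) by (auto simp: in_segment)
  have "s < 1" using s \<open>b \<noteq> p\<close> by (cases "s = 1") auto
  have "n \<bullet> b = (1 - s) * (n \<bullet> q) + s * (n \<bullet> p)"
    using s(3) by (simp add: inner_add_right)
  also have "\<dots> < (1 - s) * (n \<bullet> b) + s * (n \<bullet> b)"
    using s(1) \<open>s < 1\<close> strict le by (intro add_less_le_mono mult_left_mono mult_strict_left_mono) auto
  finally show False by (simp add: algebra_simps)
qed

lemma has_real_derivative_Re_along_curve:
  assumes "(g has_field_derivative D) (at (\<gamma> s))" and "(\<gamma> has_vector_derivative v) (at s)"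
  shows "((\<lambda>s. Re (g (\<gamma> s))) has_real_derivative Re (v * D)) (at s)"
proof -
  have "(g \<circ> \<gamma> has_vector_derivative v * D) (at s)"
    by (rule field_vector_diff_chain_at[OF assms(2,1)])
  then have "((\<lambda>s. Re ((g \<circ> \<gamma>) s)) has_vector_derivative Re (v * D)) (at s)"
    by (rule bounded_linear.has_vector_derivative[OF bounded_linear_Re])
  then show ?thesis
    by (simp add: has_real_derivative_iff_has_vector_derivative)
qed

lemma has_vector_derivative_circle:
  "((\<lambda>s. of_real r * cis s) has_vector_derivative \<i> * (of_real r * cis s)) (at s)"
  unfolding cis_conv_exp
proof (rule has_vector_derivative_real_field)
  show "((\<lambda>z. of_real r * exp (\<i> * z)) has_field_derivative \<i> * (of_real r * exp (\<i> * of_real s))) (at (of_real s))"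
    by (auto intro!: derivative_eq_intros)
qed

text \<open>
  The Noshiro--Warschawski theorem: along the segment from \<open>a\<close> to \<open>b\<close> the real part of
  \<open>c f / (b - a)\<close> has derivative \<open>Re (c f') > 0\<close>, so the two end values differ.
\<close>

lemma inj_on_if_Re_deriv_pos:
  assumes "convex S" and "open S" and "f holomorphic_on S"
    and pos: "\<And>z. z \<in> S \<Longrightarrow> Re (c * deriv f z) > 0"
  shows "inj_on f S"
proof (rule inj_onI, rule ccontr)
  fix a b assume ab: "a \<in> S" "b \<in> S" "f a = f b" "a \<noteq> b"
  define h where "h = (\<lambda>z. c * f z / (b - a))"
  define \<gamma> where "\<gamma> = (\<lambda>t::real. a + of_real t * (b - a))"
  have "Re (h (\<gamma> 0)) < Re (h (\<gamma> 1))"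
  proof (rule DERIV_pos_imp_increasing[of 0 1 "\<lambda>t. Re (h (\<gamma> t))"])
    fix t :: real assume t: "0 \<le> t" "t \<le> 1"
    have "\<gamma> t = (1 - t) *\<^sub>R a + t *\<^sub>R b"
      by (simp add: \<gamma>_def scaleR_conv_of_real algebra_simps)
    then have S: "\<gamma> t \<in> S"
      using assms(1) ab(1,2) t by (simp add: convexD_alt)
    have "(f has_field_derivative deriv f (\<gamma> t)) (at (\<gamma> t))"
      using holomorphic_derivI[OF assms(3,2) S] .
    then have "(h has_field_derivative c * deriv f (\<gamma> t) / (b - a)) (at (\<gamma> t))"
      unfolding h_def using ab(4) by (auto intro!: derivative_eq_intros)
    moreover have "(\<gamma> has_vector_derivative (b - a)) (at t)"
      unfolding \<gamma>_def by (auto intro!: derivative_eq_intros simp: has_vector_derivative_def scaleR_conv_of_real)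
    ultimately have "((\<lambda>t. Re (h (\<gamma> t))) has_real_derivative Re ((b - a) * (c * deriv f (\<gamma> t) / (b - a)))) (at t)"
      by (rule has_real_derivative_Re_along_curve)
    then show "\<exists>y. ((\<lambda>t. Re (h (\<gamma> t))) has_real_derivative y) (at t) \<and> 0 < y"
      using pos[OF S] ab(4) by auto
  qed simp
  then show False using ab(3) by (simp add: \<gamma>_def h_def)
qed

text \<open>
  The quantity \<open>Re (1 + z g'' / g')\<close> is the speed at which the tangent of the curve
  \<open>s \<mapsto> g (r cis s)\<close> turns. A holomorphic logarithm \<open>L\<close> of \<open>g'\<close> gives the turning angle
  \<open>\<tau> s = s + Im (L (r cis s))\<close>, up to a constant, as a function that is nondecreasing and grows by
  exactly \<open>2 pi\<close> over one period. For the outward normal \<open>n\<close> at a point of the curve, the function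
  \<open>s \<mapsto> n \<bullet> g (r cis s)\<close> therefore decreases for half a turn after that point and then increases
  back, so that it is maximal there. By the maximum principle the line through the point
  orthogonal to \<open>n\<close> supports the image of the whole closed disk of radius \<open>r\<close>, which is thus convex.
\<close>

lemma convex_in_disk_if_Re_nonneg:
  assumes holo: "g holomorphic_on ball 0 1" and inj: "inj_on g (ball 0 1)"
    and Re: "\<And>z. z \<in> ball 0 1 \<Longrightarrow> Re (1 + z * deriv (deriv g) z / deriv g z) \<ge> 0"
  shows "convex_in_disk g"
proof -
  have g': "deriv g z \<noteq> 0" if "z \<in> ball 0 1" for z
    using holomorphic_injective_imp_regular[OF holo open_ball inj that] .
  have holo': "deriv g holomorphic_on ball 0 1"
    using holo by (rule holomorphic_deriv) simp
  obtain L where L: "L holomorphic_on ball 0 1" "\<And>z. z \<in> ball 0 1 \<Longrightarrow> exp (L z) = deriv g z"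
    using holomorphic_logarithm_exists[OF convex_ball open_ball holo' g', of 0] by auto
  have derg: "(g has_field_derivative exp (L z)) (at z)" if "z \<in> ball 0 1" for z
    using holomorphic_derivI[OF holo open_ball that] L(2)[OF that] by simp
  have derL: "(L has_field_derivative deriv (deriv g) z / deriv g z) (at z)" if z: "z \<in> ball 0 1" for z
  proof -
    have 1: "(L has_field_derivative deriv L z) (at z)"
      using holomorphic_derivI[OF L(1) open_ball z] .
    then have "((\<lambda>z. exp (L z)) has_field_derivative exp (L z) * deriv L z) (at z)"
      by (auto intro!: derivative_eq_intros)
    then have "(deriv g has_field_derivative exp (L z) * deriv L z) (at z)"
      by (rule DERIV_cong_ev[THEN iffD1, rotated 3])
         (use L(2) eventually_nhds_in_open[OF open_ball z] in \<open>auto elim!: eventually_mono\<close>)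
    then have "deriv (deriv g) z = deriv g z * deriv L z"
      using L(2)[OF z] by (simp add: DERIV_imp_deriv)
    then show ?thesis using 1 g'[OF z] by simp
  qed
  have conv: "convex (g ` cball 0 r)" if r: "0 < r" "r < 1" for r
  proof -
    have in_disk: "of_real r * cis s \<in> ball 0 1" for s
      using r by (simp add: norm_mult)
    define \<tau> where "\<tau> = (\<lambda>s. s + Im (L (of_real r * cis s)))"
    have \<tau>': "\<exists>y. (\<tau> has_real_derivative y) (at s) \<and> y \<ge> 0" for s
    proof -
      let ?z = "of_real r * cis s"
      let ?D = "deriv (deriv g) ?z / deriv g ?z"
      have "((\<lambda>z. -\<i> * L z) has_field_derivative -\<i> * ?D) (at ?z)"
        using derL[OF in_disk] by (rule DERIV_cmult)
      from has_real_derivative_Re_along_curve[where \<gamma> = "\<lambda>s. of_real r * cis s", OF this has_vector_derivative_circle]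
      have "((\<lambda>s. Im (L (of_real r * cis s))) has_real_derivative Re (\<i> * ?z * (-\<i> * ?D))) (at s)"
        by simp
      moreover have "\<i> * z * (-\<i> * d) = z * d" for z d :: complex
        by (simp add: complex_eq_iff)
      then have "\<i> * ?z * (-\<i> * ?D) = ?z * ?D" .
      ultimately have "((\<lambda>s. Im (L (of_real r * cis s))) has_real_derivative Re (?z * ?D)) (at s)"
        by (simp only:)
      then have "(\<tau> has_real_derivative 1 + Re (?z * ?D)) (at s)"
        unfolding \<tau>_def by (intro DERIV_add DERIV_ident)
      moreover have "1 + Re (?z * ?D) \<ge> 0"
        using Re[OF in_disk, of s] by simp
      ultimately show ?thesis by blast
    qed
    have \<tau>_mono: "\<tau> s \<le> \<tau> t" if "s \<le> t" for s t
      using DERIV_nonneg_imp_nondecreasing[OF that, of \<tau>] \<tau>' by blast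
    have \<tau>_period: "\<tau> (s + 2 * pi) = \<tau> s + 2 * pi" for s
      unfolding \<tau>_def by (simp add: cis.ctr)
    have supporting: "\<exists>n. n \<noteq> 0 \<and> (\<forall>v \<in> g ` cball 0 r. n \<bullet> v \<le> n \<bullet> g a)" if a: "norm a = r" for a
    proof -
      define \<theta> where "\<theta> = Arg2pi a"
      have a_eq: "a = of_real r * cis \<theta>"
        using Arg2pi_eq[of a] a unfolding \<theta>_def by (simp add: cis_conv_exp)
      \<comment> \<open>The vector \<open>cis (\<tau> \<theta>)\<close> points in the direction of \<open>a g'(a)\<close>, the outward normal of the image
        curve at \<open>g a\<close>.\<close>
      define \<psi> where "\<psi> = (\<lambda>s. Re (cis (- \<tau> \<theta>) * g (of_real r * cis s)))"
      have \<psi>': "(\<psi> has_real_derivative - (r * exp (Re (L (of_real r * cis s))) * sin (\<tau> s - \<tau> \<theta>))) (at s)" for s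
      proof -
        let ?z = "of_real r * cis s"
        have "((\<lambda>z. cis (- \<tau> \<theta>) * g z) has_field_derivative cis (- \<tau> \<theta>) * exp (L ?z)) (at ?z)"
          using derg[OF in_disk] by (rule DERIV_cmult)
        from has_real_derivative_Re_along_curve[where \<gamma> = "\<lambda>s. of_real r * cis s", OF this has_vector_derivative_circle]
        have "(\<psi> has_real_derivative Re (\<i> * ?z * (cis (- \<tau> \<theta>) * exp (L ?z)))) (at s)"
          unfolding \<psi>_def .
        moreover have "\<i> * ?z * (cis (- \<tau> \<theta>) * exp (L ?z))
            = of_real (r * exp (Re (L ?z))) * (\<i> * cis (\<tau> s - \<tau> \<theta>))"
        proof -
          have "exp (L ?z) = of_real (exp (Re (L ?z))) * cis (Im (L ?z))"
            by (simp add: exp_eq_polar)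
          moreover have "cis (\<tau> s - \<tau> \<theta>) = cis s * cis (Im (L ?z)) * cis (- \<tau> \<theta>)"
            unfolding cis_mult by (rule arg_cong[of _ _ cis]) (simp add: \<tau>_def)
          ultimately show ?thesis by simp
        qed
        ultimately show ?thesis by (simp only:) simp
      qed
      \<comment> \<open>While the tangent has turned by at most \<open>pi\<close> the height \<open>\<psi>\<close> falls from \<open>\<psi> \<theta>\<close>; once it has turned
        by more than \<open>pi\<close>, the height rises until it returns to \<open>\<psi> \<theta>\<close> after a full period.\<close>
      have le1: "\<psi> s \<le> \<psi> \<theta>" if s: "\<theta> \<le> s" "s \<le> \<theta> + 2 * pi" for s
      proof (cases "\<tau> s \<le> \<tau> \<theta> + pi")
        case True
        show ?thesis
        proof (rule DERIV_nonpos_imp_nonincreasing[OF s(1)])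
          fix x assume x: "\<theta> \<le> x" "x \<le> s"
          have "sin (\<tau> x - \<tau> \<theta>) \<ge> 0"
            using \<tau>_mono[OF x(1)] \<tau>_mono[OF x(2)] True by (intro sin_ge_zero) auto
          then show "\<exists>y. (\<psi> has_real_derivative y) (at x) \<and> y \<le> 0"
            using \<psi>'[of x] r(1) by (intro exI conjI) auto
        qed
      next
        case False
        have "\<psi> s \<le> \<psi> (\<theta> + 2 * pi)"
        proof (rule DERIV_nonneg_imp_nondecreasing[OF s(2)])
          fix x assume x: "s \<le> x" "x \<le> \<theta> + 2 * pi"
          have "sin (\<tau> x - \<tau> \<theta>) = - sin (\<tau> x - \<tau> \<theta> - pi)"
            by (simp add: sin_diff)
          moreover have "sin (\<tau> x - \<tau> \<theta> - pi) \<ge> 0"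
            using \<tau>_mono[OF x(1)] \<tau>_mono[OF x(2)] False \<tau>_period[of \<theta>] by (intro sin_ge_zero) auto
          ultimately have "sin (\<tau> x - \<tau> \<theta>) \<le> 0" by simp
          then have "r * exp (Re (L (of_real r * cis x))) * sin (\<tau> x - \<tau> \<theta>) \<le> 0"
            using r(1) by (intro mult_nonneg_nonpos) auto
          then show "\<exists>y. (\<psi> has_real_derivative y) (at x) \<and> y \<ge> 0"
            using \<psi>'[of x] by (intro exI conjI) auto
        qed
        also have "\<psi> (\<theta> + 2 * pi) = \<psi> \<theta>"
          unfolding \<psi>_def by (simp add: cis.ctr)
        finally show ?thesis .
      qed
      have le2: "Re (cis (- \<tau> \<theta>) * g z) \<le> \<psi> \<theta>" if z: "norm z = r" for z
      proof -
        define s where "s = \<theta> + Arg2pi (z / a)"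
        have "a \<noteq> 0" using a r by auto
        have "z / a = cis (Arg2pi (z / a))"
          using Arg2pi_eq[of "z / a"] z a r by (simp add: cis_conv_exp norm_divide)
        then have "z = a * cis (Arg2pi (z / a))"
          using \<open>a \<noteq> 0\<close> by (metis nonzero_mult_div_cancel_left times_divide_eq_right)
        then have "z = of_real r * cis s"
          unfolding s_def by (metis a_eq cis_mult mult.assoc)
        moreover have "\<theta> \<le> s" "s \<le> \<theta> + 2 * pi"
          using Arg2pi_ge_0[of "z / a"] Arg2pi_lt_2pi[of "z / a"] by (auto simp: s_def)
        ultimately show ?thesis using le1[of s] unfolding \<psi>_def by simp
      qed
      have "Re (cis (- \<tau> \<theta>) * g z) \<le> \<psi> \<theta>" if z: "z \<in> cball 0 r" for z
      proof (rule maximum_real_frontier[of "\<lambda>z. cis (- \<tau> \<theta>) * g z" "cball 0 r"])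
        show "(\<lambda>z. cis (- \<tau> \<theta>) * g z) holomorphic_on interior (cball 0 r)"
          using r by (intro holomorphic_intros holomorphic_on_subset[OF holo]) auto
        show "continuous_on (closure (cball 0 r)) (\<lambda>z. cis (- \<tau> \<theta>) * g z)"
          using r by (intro continuous_intros holomorphic_on_imp_continuous_on holomorphic_on_subset[OF holo]) auto
      qed (use le2 z r in \<open>auto simp: dist_norm\<close>)
      moreover have "\<psi> \<theta> = Re (cis (- \<tau> \<theta>) * g a)"
        unfolding \<psi>_def a_eq[symmetric] ..
      moreover have "cis (\<tau> \<theta>) \<bullet> v = Re (cis (- \<tau> \<theta>) * v)" for v
        by (simp add: inner_complex_def)
      ultimately show ?thesis
        by (intro exI[of _ "cis (\<tau> \<theta>)"]) auto
    qed
    have cb: "cball 0 r \<subseteq> ball (0::complex) 1" using r by auto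
    have op: "open (g ` ball 0 r)"
      using r by (intro open_mapping_thm3 holomorphic_on_subset[OF holo] inj_on_subset[OF inj]) auto
    have sub: "g ` ball 0 r \<subseteq> interior (g ` cball 0 r)"
      using op by (intro interior_maximal) auto
    have cl: "closed (g ` cball 0 r)"
      by (intro compact_imp_closed compact_continuous_image holomorphic_on_imp_continuous_on
          holomorphic_on_subset[OF holo cb]) simp
    show ?thesis
    proof (rule convex_if_supporting_hyperplanes[OF cl])
      show "interior (g ` cball 0 r) \<noteq> {}"
        using sub r(1) by auto
      fix b assume b: "b \<in> frontier (g ` cball 0 r)"
      then have "b \<in> g ` cball 0 r" "b \<notin> g ` ball 0 r"
        using cl sub by (auto simp: frontier_def)
      then obtain a where a: "b = g a" "a \<in> cball 0 r" "a \<notin> ball 0 r" by blast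
      from a(2,3) have "norm a = r" by simp
      from supporting[OF this] show "\<exists>n. n \<noteq> 0 \<and> (\<forall>v \<in> g ` cball 0 r. n \<bullet> v \<le> n \<bullet> b)"
        unfolding a(1) .
    qed
  qed
  have "convex (g ` ball 0 1)"
    unfolding convex_contains_segment
  proof (intro ballI)
    fix x y assume "x \<in> g ` ball 0 1" "y \<in> g ` ball 0 1"
    then obtain a b where ab: "x = g a" "y = g b" "norm a < 1" "norm b < 1" by auto
    obtain r where r: "max (norm a) (norm b) < r" "r < 1"
      using dense[of "max (norm a) (norm b)" 1] ab(3,4) by auto
    have "0 < r" using r(1) norm_ge_zero[of a] by linarith
    have "x \<in> g ` cball 0 r" "y \<in> g ` cball 0 r" using ab r by auto
    then have "closed_segment x y \<subseteq> g ` cball 0 r"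
      using conv[OF \<open>0 < r\<close> r(2)] unfolding convex_contains_segment by blast
    also have "\<dots> \<subseteq> g ` ball 0 1" using r by auto
    finally show "closed_segment x y \<subseteq> g ` ball 0 1" .
  qed
  then show ?thesis using holo inj by (simp add: convex_in_disk_def univalent_in_disk_def)
qed

text \<open>
  Let \<open>h\<close> be the inverse of \<open>f\<close>. The condition says that \<open>u \<mapsto> norm (h (u * f z))\<close> is nondecreasing:
  moving towards the origin in the image, the preimages cannot approach the unit circle, so the
  ray cannot leave the image.
\<close>

lemma starlike_in_disk_if_Re_nonneg:
  assumes holo: "f holomorphic_on ball 0 1" and inj: "inj_on f (ball 0 1)" and "f 0 = 0"
    and Re: "\<And>z. z \<in> ball 0 1 \<Longrightarrow> z \<noteq> 0 \<Longrightarrow> Re (z * deriv f z / f z) \<ge> 0"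
  shows "starlike_in_disk f"
proof -
  let ?D = "ball (0::complex) 1"
  have op: "open (f ` ?D)" by (rule open_mapping_thm3[OF holo open_ball inj])
  obtain h where h: "h holomorphic_on f ` ?D" "\<And>z. z \<in> ?D \<Longrightarrow> deriv f z * deriv h (f z) = 1"
      "\<And>z. z \<in> ?D \<Longrightarrow> h (f z) = z"
    using holomorphic_has_inverse[OF holo open_ball inj] by metis
  have "of_real t * f z \<in> f ` ?D" if z: "z \<in> ?D" and t: "0 \<le> t" "t \<le> 1" for z t
  proof (rule ccontr)
    assume out: "of_real t * f z \<notin> f ` ?D"
    \<comment> \<open>The last parameter \<open>t0\<close> at which the ray is outside the image leads to a contradiction, because
      the points just after it have preimages in the compact disk of radius \<open>norm z\<close>.\<close>
    define E where "E = {t. 0 \<le> t \<and> t \<le> 1 \<and> of_real t * f z \<notin> f ` ?D}"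
    have "t \<in> E" using t out by (simp add: E_def)
    have E_eq: "E = {0..1} \<inter> (\<lambda>t. of_real t * f z) -` (- (f ` ?D))"
      by (auto simp: E_def)
    have "closed E"
      unfolding E_eq using op by (intro closed_Int closed_atLeastAtMost closed_vimage continuous_intros) (simp add: closed_Compl)
    have bdd: "bdd_above E" unfolding E_def by (rule bdd_aboveI[of _ 1]) simp
    define t0 where "t0 = Sup E"
    have t0: "t0 \<in> E"
      unfolding t0_def using \<open>t \<in> E\<close> bdd \<open>closed E\<close> by (intro closed_contains_Sup) auto
    have "t0 \<noteq> 1" using t0 z by (auto simp: E_def)
    moreover have "t0 \<noteq> 0"
      using t0 \<open>f 0 = 0\<close> by (auto simp: E_def image_iff dest!: bspec[of _ _ 0])
    ultimately have t01: "0 < t0" "t0 < 1" using t0 by (auto simp: E_def)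
    have inside: "of_real s * f z \<in> f ` ?D" if "t0 < s" "s \<le> 1" for s
    proof (rule ccontr)
      assume "of_real s * f z \<notin> f ` ?D"
      then have "s \<in> E" using that t01 by (simp add: E_def)
      then have "s \<le> t0" unfolding t0_def by (intro cSup_upper bdd)
      with that show False by simp
    qed
    have fz: "f z \<noteq> 0"
      using t0 \<open>f 0 = 0\<close> by (auto simp: E_def image_iff dest!: bspec[of _ _ 0])
    have near: "of_real s * f z \<in> f ` cball 0 (norm z)" if s: "t0 < s" "s \<le> 1" for s
    proof -
      define w where "w = (\<lambda>u. h (of_real u * f z))"
      have w: "w u \<in> ?D" "f (w u) = of_real u * f z" if u: "s \<le> u" "u \<le> 1" for u
        using inside[of u] h(3) u s by (auto simp: w_def)
      have "ln (norm (w s)) \<le> ln (norm (w 1))"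
      proof (rule DERIV_nonneg_imp_nondecreasing[OF s(2), of "\<lambda>u. ln (norm (w u))"])
        fix u assume u: "s \<le> u" "u \<le> 1"
        have "u > 0" using u(1) s(1) t01(1) by linarith
        have fw: "f (w u) \<noteq> 0" using w(2)[OF u] fz \<open>u > 0\<close> by simp
        then have w0: "w u \<noteq> 0" using \<open>f 0 = 0\<close> by metis
        have dh: "(h has_field_derivative deriv h (f (w u))) (at (f (w u)))"
          using holomorphic_derivI[OF h(1) op] w(1)[OF u] by blast
        have d0: "deriv f (w u) \<noteq> 0" and dhe: "deriv h (f (w u)) = 1 / deriv f (w u)"
          using h(2)[OF w(1)[OF u]] by (auto simp: eq_divide_eq mult.commute)
        have "((\<lambda>u. of_real u * f z) has_vector_derivative f z) (at u)"
          by (auto intro!: derivative_eq_intros simp: has_vector_derivative_def scaleR_conv_of_real)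
        then have "(h \<circ> (\<lambda>u. of_real u * f z) has_vector_derivative f z * deriv h (f (w u))) (at u)"
          by (rule field_vector_diff_chain_at) (use dh w(2)[OF u] in simp)
        then have "(h \<circ> (\<lambda>u. of_real u * f z) has_vector_derivative f z / deriv f (w u)) (at u)"
          unfolding dhe by (simp only: times_divide_eq_right mult_1_right)
        then have dw: "(w has_vector_derivative f z / deriv f (w u)) (at u)"
          by (simp only: w_def o_def)
        have "((\<lambda>u. norm (w u)) has_derivative (\<lambda>x. (x *\<^sub>R (f z / deriv f (w u))) \<bullet> sgn (w u))) (at u)"
          using has_derivative_norm[OF w0] dw unfolding has_vector_derivative_def
          by (rule has_derivative_compose[rotated])
        then have "((\<lambda>u. norm (w u)) has_real_derivative (f z / deriv f (w u)) \<bullet> sgn (w u)) (at u)"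
          by (simp add: has_field_derivative_def mult_commute_abs)
        then have "((\<lambda>u. ln (norm (w u))) has_real_derivative 1 / norm (w u) * ((f z / deriv f (w u)) \<bullet> sgn (w u))) (at u)"
          using w0 by (auto intro!: derivative_eq_intros)
        moreover have "1 / norm (w u) * ((f z / deriv f (w u)) \<bullet> sgn (w u)) \<ge> 0"
        proof -
          define q where "q = w u * deriv f (w u) / f (w u)"
          have "w u / q = f (w u) / deriv f (w u)"
            using w0 by (simp add: q_def)
          then have "f z / deriv f (w u) = (1 / u) *\<^sub>R (w u / q)"
            using \<open>u > 0\<close> unfolding w(2)[OF u] scaleR_conv_of_real by simp
          moreover have "(w u / q) \<bullet> w u \<ge> 0"
          proof -
            have "x \<bullet> y = Re (x * cnj y)" for x y :: complex
              by (simp add: inner_complex_def)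
            then have "(w u / q) \<bullet> w u = Re (w u / q * cnj (w u))" .
            also have "w u / q * cnj (w u) = of_real ((norm (w u))\<^sup>2) * inverse q"
              using complex_norm_square[of "w u"] by (simp add: divide_inverse mult_ac)
            also have "Re \<dots> = (norm (w u))\<^sup>2 * Re (inverse q)"
              by simp
            finally show ?thesis
              using Re[OF w(1)[OF u] w0] unfolding q_def[symmetric] by simp
          qed
          ultimately show ?thesis using \<open>u > 0\<close> by (simp add: sgn_div_norm)
        qed
        ultimately show "\<exists>y. ((\<lambda>u. ln (norm (w u))) has_real_derivative y) (at u) \<and> y \<ge> 0"
          by blast
      qed
      moreover have "w s \<noteq> 0"
        using w(2)[of s] s t01 fz \<open>f 0 = 0\<close> by auto
      moreover have "w 1 = z" using h(3)[OF z] by (simp add: w_def)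
      moreover have "z \<noteq> 0" using fz \<open>f 0 = 0\<close> by auto
      ultimately have "norm (w s) \<le> norm z" by simp
      then show ?thesis using w(2)[of s] s by (metis image_eqI mem_cball_0 order_refl)
    qed
    have "of_real t0 * f z \<in> f ` cball 0 (norm z)"
    proof (rule Lim_in_closed_set[of _ "\<lambda>s. of_real s * f z" "at_right t0"])
      show "closed (f ` cball 0 (norm z))"
        using z by (intro compact_imp_closed compact_continuous_image
            holomorphic_on_imp_continuous_on holomorphic_on_subset[OF holo]) auto
      show "\<forall>\<^sub>F s in at_right t0. of_real s * f z \<in> f ` cball 0 (norm z)"
        using eventually_at_right_real[OF t01(2)] by eventually_elim (auto intro: near)
    qed (auto intro!: tendsto_intros)
    then have "of_real t0 * f z \<in> f ` ?D" using z by auto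
    then show False using t0 by (simp add: E_def)
  qed
  then show ?thesis
    using assms(1-3) unfolding starlike_in_disk_def univalent_in_disk_def
    by (auto simp: in_segment scaleR_conv_of_real)
qed

section \<open>Convex maps with real coefficients\<close>

lemma pos_if_continuous_nonzero:
  fixes f :: "real \<Rightarrow> real"
  assumes "continuous_on {a..b} f" and "f a > 0" and "\<And>x. x \<in> {a..b} \<Longrightarrow> f x \<noteq> 0" and "a \<le> b"
  shows "f b > 0"
proof (rule ccontr)
  assume "\<not> f b > 0"
  then have "\<exists>x. a \<le> x \<and> x \<le> b \<and> f x = 0"
    using assms(1,2,4) by (intro IVT2') auto
  with assms(3) show False by auto
qed

lemma cnj_symmetric_imp_real:
  assumes "\<And>z. z \<in> ball 0 1 \<Longrightarrow> g (cnj z) = cnj (g z)" and "\<bar>t\<bar> < 1"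
  shows "g (of_real t) = of_real (Re (g (of_real t)))"
  using assms(1)[of "of_real t"] assms(2) by (simp add: complex_eq_iff)

lemma symmetric_deriv_real:
  assumes holo: "g holomorphic_on ball 0 1" 
    and sym: "\<And>z. z \<in> ball 0 1 \<Longrightarrow> g (cnj z) = cnj (g z)"
    and t: "\<bar>t\<bar> < 1"
  shows "deriv g (of_real t) = of_real (Re (deriv g (of_real t)))"
    and "((\<lambda>t. Re (g (of_real t))) has_real_derivative Re (deriv g (of_real t))) (at t)"
proof -
  have "(g has_field_derivative deriv g (of_real t)) (at (of_real t))"
    using t by (intro holomorphic_derivI[OF holo]) auto
  then have d: "((\<lambda>t. g (of_real t)) has_vector_derivative deriv g (of_real t)) (at t)"
    by (rule has_vector_derivative_real_field)
  from bounded_linear.has_vector_derivative[OF bounded_linear_Re d]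
  show "((\<lambda>t. Re (g (of_real t))) has_real_derivative Re (deriv g (of_real t))) (at t)"
    by (simp add: has_real_derivative_iff_has_vector_derivative)
  have "((\<lambda>t. Im (g (of_real t))) has_vector_derivative Im (deriv g (of_real t))) (at t)"
    by (rule bounded_linear.has_vector_derivative[OF bounded_linear_Im d])
  moreover have "((\<lambda>t. Im (g (of_real t))) has_vector_derivative 0) (at t)"
  proof (rule has_vector_derivative_transform_within_open[of "\<lambda>_. 0" _ _ "{-1<..<1}"])
    show "0 = Im (g (of_real x))" if "x \<in> {-1<..<1}" for x
      using cnj_symmetric_imp_real[of g x, OF sym] that by (metis Im_complex_of_real abs_less_iff greaterThanLessThan_iff minus_less_iff)
  qed (use t in auto)
  ultimately have "Im (deriv g (of_real t)) = 0"
    by (rule vector_derivative_unique_at)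
  then show "deriv g (of_real t) = of_real (Re (deriv g (of_real t)))"
    by (simp add: complex_eq_iff)
qed

lemma univalent_symmetric_deriv_pos:
  assumes uni: "univalent_in_disk g"
    and sym: "\<And>z. z \<in> ball 0 1 \<Longrightarrow> g (cnj z) = cnj (g z)"
    and pos: "Re (deriv g 0) > 0" and t: "\<bar>t\<bar> < 1"
  shows "Re (deriv g (of_real t)) > 0"
proof -
  note holo = uni[unfolded univalent_in_disk_def, THEN conjunct1]
  note inj = uni[unfolded univalent_in_disk_def, THEN conjunct2]
  have main: "Re (deriv g (of_real (c * s))) > 0" if s: "0 \<le> s" "s < 1" and c: "\<bar>c\<bar> = 1" for c s
  proof (rule pos_if_continuous_nonzero[of 0 s "\<lambda>s. Re (deriv g (of_real (c * s)))"])
    have "continuous_on (ball 0 1) (deriv g)"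
      by (intro holomorphic_on_imp_continuous_on holomorphic_deriv holo open_ball)
    then show "continuous_on {0..s} (\<lambda>s. Re (deriv g (of_real (c * s))))"
      using s c by (intro continuous_intros) (auto elim!: continuous_on_compose2 intro!: continuous_intros simp: norm_mult)
    show "Re (deriv g (of_real (c * x))) \<noteq> 0" if "x \<in> {0..s}" for x
    proof -
      have x: "\<bar>c * x\<bar> < 1" using that s c by (simp add: abs_mult)
      then have "deriv g (of_real (c * x)) \<noteq> 0"
        by (intro holomorphic_injective_imp_regular[OF holo open_ball inj]) (simp del: of_real_mult)
      then show ?thesis using symmetric_deriv_real(1)[OF holo sym x] by (metis of_real_0)
    qed
  qed (use pos s in auto)
  show ?thesis
    using main[of "\<bar>t\<bar>" 1] main[of "\<bar>t\<bar>" "-1"] t by (cases "t < 0") auto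
qed

text \<open>
  Put \<open>z = u r\<close> with \<open>r = norm z\<close>. The mean of \<open>g (u \<zeta>)\<close> and \<open>g (cnj u * \<zeta>)\<close> stays in the convex
  image of \<open>g\<close>, so it is subordinate to \<open>g\<close>, and by the Schwarz lemma its value \<open>Re (g z)\<close> at
  \<open>\<zeta> = r\<close> is \<open>g t\<close> for some \<open>t\<close> with \<open>norm t \<le> r\<close>. This \<open>t\<close> is real by symmetry, and \<open>g\<close> increases
  on the real axis.
\<close>

lemma convex_symmetric_Re_le:
  assumes conv: "convex_in_disk g"
    and sym: "\<And>z. z \<in> ball 0 1 \<Longrightarrow> g (cnj z) = cnj (g z)"
    and pos: "Re (deriv g 0) > 0" and z: "z \<in> ball 0 1"
  shows "Re (g z) \<le> Re (g (of_real (norm z)))"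
proof (cases "z = 0")
  case False
  let ?D = "ball (0::complex) 1"
  have uni: "univalent_in_disk g" and cvx: "convex (g ` ?D)"
    using conv by (auto simp: convex_in_disk_def)
  then have holo: "g holomorphic_on ?D" and inj: "inj_on g ?D"
    by (auto simp: univalent_in_disk_def)
  obtain h where h: "h holomorphic_on g ` ?D" "\<And>z. z \<in> ?D \<Longrightarrow> h (g z) = z"
    using holomorphic_has_inverse[OF holo open_ball inj] by metis
  define r where "r = norm z"
  define u where "u = z / of_real r"
  have r: "0 < r" "r < 1" and u: "norm u = 1" "z = u * of_real r"
    using False z by (auto simp: r_def u_def norm_divide)
  define M where "M = (\<lambda>\<zeta>. (g (u * \<zeta>) + g (cnj u * \<zeta>)) / 2)"
  define w where "w = (\<lambda>\<zeta>. h (M \<zeta>))"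
  have rot: "u * \<zeta> \<in> ?D" "cnj u * \<zeta> \<in> ?D" if "\<zeta> \<in> ?D" for \<zeta>
    using that u(1) by (auto simp: norm_mult)
  have M: "M \<zeta> \<in> g ` ?D" if "\<zeta> \<in> ?D" for \<zeta>
  proof -
    have "(1/2) *\<^sub>R g (u * \<zeta>) + (1/2) *\<^sub>R g (cnj u * \<zeta>) \<in> g ` ?D"
      using rot[OF that] by (intro convexD[OF cvx]) auto
    then show ?thesis by (simp add: M_def scaleR_conv_of_real add_divide_distrib)
  qed
  have w: "w \<zeta> \<in> ?D" "g (w \<zeta>) = M \<zeta>" if "\<zeta> \<in> ?D" for \<zeta>
    using M[OF that] h(2) by (auto simp: w_def)
  have "norm (w (of_real r)) \<le> norm (complex_of_real r)"
  proof (rule Schwarz_Lemma(1))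
    have "(g \<circ> (\<lambda>\<zeta>. u * \<zeta>)) holomorphic_on ?D" "(g \<circ> (\<lambda>\<zeta>. cnj u * \<zeta>)) holomorphic_on ?D"
      using rot by (intro holomorphic_on_compose_gen[OF _ holo] holomorphic_intros; auto)+
    then have "M holomorphic_on ?D"
      unfolding M_def by (intro holomorphic_intros) (auto simp: o_def)
    then have "(h \<circ> M) holomorphic_on ?D"
      using M by (intro holomorphic_on_compose_gen[OF _ h(1)]) auto
    then show "w holomorphic_on ball 0 1" by (simp add: w_def[abs_def] o_def)
    show "w 0 = 0" using h(2)[of 0] by (simp add: w_def M_def)
  qed (use w r in auto)
  then have le: "norm (w (of_real r)) \<le> r" using r by simp
  have rD: "complex_of_real r \<in> ?D" using r by simp
  have M_eq: "M (of_real r) = of_real (Re (g z))"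
  proof -
    have "cnj u * of_real r = cnj z" by (simp add: u(2))
    then have "M (of_real r) = (g z + cnj (g z)) / 2"
      unfolding M_def u(2)[symmetric] sym[OF z, symmetric] by (simp only:)
    then show ?thesis by (simp add: complex_eq_iff)
  qed
  have "g (cnj (w (of_real r))) = g (w (of_real r))"
    using sym[OF w(1)[OF rD]] w(2)[OF rD] M_eq by simp
  then have "cnj (w (of_real r)) = w (of_real r)"
    using inj_onD[OF inj] w(1)[OF rD] by simp
  then have w_real: "w (of_real r) = of_real (Re (w (of_real r)))"
    by (simp add: complex_eq_iff)
  define t where "t = Re (w (of_real r))"
  have wt: "w (of_real r) = of_real t" using w_real by (simp add: t_def)
  have t: "\<bar>t\<bar> \<le> r" using le unfolding wt by simp
  have "Re (g (of_real t)) \<le> Re (g (of_real r))"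
  proof (rule DERIV_nonneg_imp_nondecreasing[of t r "\<lambda>t. Re (g (of_real t))"])
    fix x assume "t \<le> x" "x \<le> r"
    then have x: "\<bar>x\<bar> < 1" using t r by auto
    show "\<exists>y. ((\<lambda>t. Re (g (of_real t))) has_real_derivative y) (at x) \<and> y \<ge> 0"
      using symmetric_deriv_real(2)[OF holo sym x]
        univalent_symmetric_deriv_pos[OF uni sym pos x] by (intro exI conjI) auto
  qed (use t in auto)
  moreover have "Re (g z) = Re (g (of_real t))"
    using w(2)[OF rD] M_eq wt by simp
  ultimately show ?thesis by (simp add: r_def)
qed simp

text \<open>
  The necessary condition for convexity on the positive axis: by the previous lemma
  \<open>\<theta> \<mapsto> Re (g (r cis \<theta>))\<close> is maximal at \<open>\<theta> = 0\<close>, and its second derivative there is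
  \<open>- r (g'(r) + r g''(r))\<close>.
\<close>

lemma convex_symmetric_imp_nonneg:
  assumes conv: "convex_in_disk g"
    and sym: "\<And>z. z \<in> ball 0 1 \<Longrightarrow> g (cnj z) = cnj (g z)"
    and pos: "Re (deriv g 0) > 0" and r: "0 < r" "r < 1"
  shows "Re (deriv g (of_real r) + of_real r * deriv (deriv g) (of_real r)) \<ge> 0"
proof (rule ccontr)
  let ?\<gamma> = "\<lambda>\<theta>. of_real r * cis \<theta>"
  define \<kappa> where "\<kappa> = Re (deriv g (of_real r) + of_real r * deriv (deriv g) (of_real r))"
  assume "\<not> ?thesis"
  then have neg: "\<kappa> < 0" by (simp add: \<kappa>_def)
  have holo: "g holomorphic_on ball 0 1"
    using conv by (auto simp: convex_in_disk_def univalent_in_disk_def)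
  have in_disk: "?\<gamma> \<theta> \<in> ball 0 1" for \<theta>
    using r by (simp add: norm_mult)
  define \<psi> where "\<psi> = (\<lambda>\<theta>. Re (g (?\<gamma> \<theta>)))"
  define \<psi>' where "\<psi>' = (\<lambda>\<theta>. Re (\<i> * ?\<gamma> \<theta> * deriv g (?\<gamma> \<theta>)))"
  have d1: "(\<psi> has_real_derivative \<psi>' \<theta>) (at \<theta>)" for \<theta>
    unfolding \<psi>_def \<psi>'_def
    by (rule has_real_derivative_Re_along_curve[OF holomorphic_derivI[OF holo open_ball in_disk] has_vector_derivative_circle])
  have d2: "(\<psi>' has_real_derivative - r * \<kappa>) (at 0)"
  proof -
    have "deriv g holomorphic_on ball 0 1" by (rule holomorphic_deriv[OF holo open_ball])
    from holomorphic_derivI[OF this open_ball in_disk[of 0]]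
    have "((\<lambda>z. \<i> * z * deriv g z) has_field_derivative
            \<i> * (deriv g (?\<gamma> 0) + ?\<gamma> 0 * deriv (deriv g) (?\<gamma> 0))) (at (?\<gamma> 0))"
      by (auto intro!: derivative_eq_intros simp: algebra_simps)
    from has_real_derivative_Re_along_curve[where \<gamma> = ?\<gamma>, OF this has_vector_derivative_circle]
    show ?thesis unfolding \<psi>'_def \<kappa>_def by (simp add: algebra_simps)
  qed
  have \<psi>'0: "\<psi>' 0 = 0"
    using symmetric_deriv_real(1)[OF holo sym, of r] r
    by (simp add: \<psi>'_def) (metis Im_complex_of_real)
  have "- r * \<kappa> > 0" using neg r(1) by (simp add: mult_pos_neg)
  from DERIV_pos_inc_right[OF d2 this] obtain d
    where d: "d > 0" "\<And>h. 0 < h \<Longrightarrow> h < d \<Longrightarrow> \<psi>' h > 0" unfolding \<psi>'0 by auto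
  have "\<psi> 0 < \<psi> (d / 2)"
    using d d1 by (intro DERIV_pos_imp_increasing_open[of 0 "d/2" \<psi>])
      (force intro!: continuous_at_imp_continuous_on DERIV_isCont)+
  moreover have "\<psi> (d / 2) \<le> \<psi> 0"
    using convex_symmetric_Re_le[OF conv sym pos in_disk[of "d/2"]] r
    by (simp add: \<psi>_def norm_mult)
  ultimately show False by simp
qed

section \<open>A coefficient criterion for convexity\<close>

text \<open>
  Since \<open>n\<^sup>2 = n + n (n - 1)\<close>, the hypothesis, which is \<open>\<Sum>n\<ge>2. n\<^sup>2 \<bar>p\<^sub>n\<bar> \<le> \<bar>p\<^sub>1\<bar>\<close>, controls at the same
  time the distance of \<open>P'\<close> from \<open>p\<^sub>1\<close> and the size of \<open>z P''\<close>. The first bound puts \<open>P' / p\<^sub>1\<close> in the right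
  half-plane, which gives univalence, and both together give \<open>\<bar>z P''\<bar> < \<bar>P'\<bar>\<close>, which gives convexity.
\<close>

lemma convex_in_disk_coefficient_criterion:
  fixes P :: "complex fps"
  assumes rad: "fps_conv_radius P \<ge> 1" and nz: "fps_nth P 1 \<noteq> 0"
    and summ: "summable (\<lambda>n. (real n + 2)\<^sup>2 * norm (fps_nth P (n + 2)))"
    and le: "(\<Sum>n. (real n + 2)\<^sup>2 * norm (fps_nth P (n + 2))) \<le> norm (fps_nth P 1)"
  shows "convex_in_disk (eval_fps P)"
proof -
  define p where "p = fps_nth P 1"
  define G where "G = fps_deriv P"
  have eball: "z \<in> eball 0 (fps_conv_radius P)" if "z \<in> ball 0 1" for z :: complex
  proof -
    have "ereal (norm z) < 1" using that by (simp add: one_ereal_def)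
    from less_le_trans[OF this rad] show ?thesis by simp
  qed
  have holo: "eval_fps P holomorphic_on ball 0 1"
    using eball by (intro holomorphic_intros) auto
  have radG: "fps_conv_radius G \<ge> fps_conv_radius P"
    unfolding G_def by (rule fps_conv_radius_deriv)
  have inG: "norm z < fps_conv_radius G" "norm z < fps_conv_radius (fps_deriv G)"
    if "z \<in> ball 0 1" for z :: complex
    using eball[OF that] radG fps_conv_radius_deriv[of G] by auto
  have d1: "deriv (eval_fps P) z = eval_fps G z" if "z \<in> ball 0 1" for z
    unfolding G_def using eball[OF that] by (intro eval_fps_deriv[symmetric]) simp
  have d2: "deriv (deriv (eval_fps P)) z = eval_fps (fps_deriv G) z" if z: "z \<in> ball 0 1" for z
  proof -
    have "deriv (deriv (eval_fps P)) z = deriv (eval_fps G) z"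
      by (rule deriv_cong_ev) (use eventually_nhds_in_open[OF open_ball z] d1 in \<open>auto elim!: eventually_mono\<close>)
    also have "\<dots> = eval_fps (fps_deriv G) z"
      using inG[OF z] by (intro eval_fps_deriv[symmetric])
    finally show ?thesis .
  qed
  have key: "norm (eval_fps G z - p) + norm (z * eval_fps (fps_deriv G) z) < norm p"
    if z: "z \<in> ball 0 1" for z
  proof -
    define r where "r = norm z"
    have r: "0 \<le> r" "r < 1" using z by (auto simp: r_def)
    have "(\<lambda>n. fps_nth G n * z ^ n) sums eval_fps G z"
      using inG(1)[OF z] by (rule sums_eval_fps)
    then have s1: "(\<lambda>n. fps_nth G (Suc n) * z ^ Suc n) sums (eval_fps G z - p)"
      by (subst sums_Suc_iff) (simp add: G_def p_def)
    have "(\<lambda>n. fps_nth (fps_deriv G) n * z ^ n) sums eval_fps (fps_deriv G) z"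
      using inG(2)[OF z] by (rule sums_eval_fps)
    then have s2: "(\<lambda>n. of_nat (Suc n) * fps_nth G (Suc n) * z ^ Suc n) sums (z * eval_fps (fps_deriv G) z)"
      using sums_mult[of _ _ z] by (fastforce simp: mult_ac)
    define A where "A = (\<lambda>n. (real n + 2)\<^sup>2 * norm (fps_nth P (n + 2)))"
    have sA: "summable (\<lambda>n. r * A n)"
      unfolding A_def by (intro summable_mult summ)
    have nG: "norm (fps_nth G (Suc n)) = (real n + 2) * norm (fps_nth P (n + 2))" for n
    proof -
      have "fps_nth G (Suc n) = of_nat (n + 2) * fps_nth P (n + 2)" by (simp add: G_def)
      then have "norm (fps_nth G (Suc n)) = norm (of_nat (n + 2) :: complex) * norm (fps_nth P (n + 2))"
        by (simp only: norm_mult)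
      also have "norm (of_nat (n + 2) :: complex) = real (n + 2)" by (rule norm_of_nat)
      finally show ?thesis by simp
    qed
    have rle: "r ^ Suc n \<le> r" for n
      using power_decreasing[of 1 "Suc n" r] r by simp
    have b: "norm (fps_nth G (Suc n) * z ^ Suc n) + norm (of_nat (Suc n) * fps_nth G (Suc n) * z ^ Suc n) \<le> r * A n" for n
    proof -
      have "norm (fps_nth G (Suc n) * z ^ Suc n) + norm (of_nat (Suc n) * fps_nth G (Suc n) * z ^ Suc n)
          = A n * r ^ Suc n"
        unfolding norm_mult norm_power nG norm_of_nat A_def r_def by (simp add: power2_eq_square algebra_simps)
      also have "\<dots> \<le> A n * r"
        using rle by (intro mult_left_mono) (simp_all add: A_def)
      finally show ?thesis by (simp add: mult.commute)
    qed
    have n1: "summable (\<lambda>n. norm (fps_nth G (Suc n) * z ^ Suc n))"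
      by (rule summable_comparison_test'[OF sA]) (use b in \<open>smt (verit) norm_ge_zero real_norm_def\<close>)
    have n2: "summable (\<lambda>n. norm (of_nat (Suc n) * fps_nth G (Suc n) * z ^ Suc n))"
      by (rule summable_comparison_test'[OF sA]) (use b in \<open>smt (verit) norm_ge_zero real_norm_def\<close>)
    have "norm (eval_fps G z - p) + norm (z * eval_fps (fps_deriv G) z)
        \<le> (\<Sum>n. norm (fps_nth G (Suc n) * z ^ Suc n)) + (\<Sum>n. norm (of_nat (Suc n) * fps_nth G (Suc n) * z ^ Suc n))"
      unfolding sums_unique[OF s1] sums_unique[OF s2] by (intro add_mono summable_norm n1 n2)
    also have "\<dots> \<le> (\<Sum>n. r * A n)"
      unfolding suminf_add[OF n1 n2] by (intro suminf_le b summable_add n1 n2 sA)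
    also have "\<dots> = r * (\<Sum>n. A n)"
      using summ by (intro suminf_mult) (simp add: A_def)
    also have "\<dots> \<le> r * norm p"
      using le r by (intro mult_left_mono) (simp_all add: A_def p_def)
    also have "\<dots> < norm p" using r nz by (simp add: p_def)
    finally show ?thesis .
  qed
  have "p \<noteq> 0" using nz by (simp add: p_def)
  have Re1: "Re (deriv (eval_fps P) z / p) > 0" if z: "z \<in> ball 0 1" for z
  proof -
    have "norm (eval_fps G z / p - 1) < 1"
    proof -
      have "norm (eval_fps G z / p - 1) = norm (eval_fps G z - p) / norm p"
        using \<open>p \<noteq> 0\<close> by (simp add: diff_divide_distrib flip: norm_divide)
      moreover have "norm (eval_fps G z - p) < norm p"
        using key[OF z] norm_ge_zero[of "z * eval_fps (fps_deriv G) z"] by linarith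
      ultimately show ?thesis using \<open>p \<noteq> 0\<close> by simp
    qed
    then have "Re (eval_fps G z / p) > 0"
      using abs_Re_le_cmod[of "eval_fps G z / p - 1"] by simp
    then show ?thesis by (simp add: d1[OF z])
  qed
  show "convex_in_disk (eval_fps P)"
  proof (rule convex_in_disk_if_Re_nonneg[OF holo])
    show "inj_on (eval_fps P) (ball 0 1)"
      using Re1 by (intro inj_on_if_Re_deriv_pos[OF convex_ball open_ball holo, of "1 / p"]) simp
    fix z :: complex assume z: "z \<in> ball 0 1"
    have "norm p \<le> norm (eval_fps G z) + norm (eval_fps G z - p)"
      using norm_triangle_ineq4[of "eval_fps G z" "eval_fps G z - p"] by simp
    then have lt: "norm (z * eval_fps (fps_deriv G) z) < norm (eval_fps G z)"
      using key[OF z] by linarith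
    have "norm (z * eval_fps (fps_deriv G) z / eval_fps G z) \<le> 1"
      using lt by (simp add: norm_divide divide_le_eq_1)
    then have "- Re (z * eval_fps (fps_deriv G) z / eval_fps G z) \<le> 1"
      using abs_Re_le_cmod[of "z * eval_fps (fps_deriv G) z / eval_fps G z"] by linarith
    then show "Re (1 + z * deriv (deriv (eval_fps P)) z / deriv (eval_fps P) z) \<ge> 0"
      unfolding d1[OF z] d2[OF z] by simp
  qed
qed

lemma close_to_convex_if_convex:
  assumes "convex_in_disk g"
  shows "close_to_convex_in_disk g"
proof -
  have g: "g holomorphic_on ball 0 1" "inj_on g (ball 0 1)"
    using assms by (auto simp: convex_in_disk_def univalent_in_disk_def)
  then have "deriv g z \<noteq> 0" if "z \<in> ball 0 1" for z
    using holomorphic_injective_imp_regular[OF _ open_ball _ that] by blast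
  then show ?thesis
    unfolding close_to_convex_in_disk_def using assms g(1) by (intro conjI exI[of _ g]) auto
qed

section \<open>Power series with nonnegative coefficients\<close>

definition nonneg_coeffs :: "complex fps \<Rightarrow> bool" where
  "nonneg_coeffs F \<longleftrightarrow> (\<forall>n. fps_nth F n \<in> \<real>\<^sub>\<ge>\<^sub>0)"

lemma nonneg_Reals_sum: "(\<And>i. i \<in> A \<Longrightarrow> f i \<in> \<real>\<^sub>\<ge>\<^sub>0) \<Longrightarrow> sum f A \<in> (\<real>\<^sub>\<ge>\<^sub>0 :: complex set)"
  by (induction A rule: infinite_finite_induct) auto

text \<open>
  In \<open>V = 1 + U V\<close> with \<open>U(0) = 0\<close> each coefficient of \<open>V\<close> is a combination of earlier ones with
  coefficients from \<open>U\<close>. Only the coefficients of \<open>U\<close> up to \<open>n\<close> enter the \<open>n\<close>-th one; the statement is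
  kept in this local form for an induction in which \<open>U\<close> is itself known only up to \<open>n\<close>.
\<close>

lemma nonneg_coeffs_renewal:
  assumes V: "V = 1 + U * V" and "fps_nth U 0 = 0" and U: "\<And>i. i \<le> n \<Longrightarrow> fps_nth U i \<in> \<real>\<^sub>\<ge>\<^sub>0"
  shows "fps_nth V n \<in> (\<real>\<^sub>\<ge>\<^sub>0 :: complex set)"
  using U
proof (induction n rule: less_induct)
  case (less n)
  have "fps_nth V n = fps_nth 1 n + (\<Sum>i=0..n. fps_nth U i * fps_nth V (n - i))"
    by (subst V) (simp add: fps_mult_nth)
  moreover have "fps_nth U i * fps_nth V (n - i) \<in> \<real>\<^sub>\<ge>\<^sub>0" if "i \<in> {0..n}" for i
  proof (cases "i = 0")
    case False
    then have "fps_nth V (n - i) \<in> \<real>\<^sub>\<ge>\<^sub>0"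
      using that by (intro less.IH less.prems) auto
    then show ?thesis using less.prems[of i] that by (intro nonneg_Reals_mult_I) auto
  qed (use assms(2) in simp)
  moreover have "fps_nth 1 n \<in> (\<real>\<^sub>\<ge>\<^sub>0 :: complex set)" by simp
  ultimately show ?case
    by (auto intro!: nonneg_Reals_add_I nonneg_Reals_sum)
qed

lemma nonneg_coeffs_mult: "nonneg_coeffs F \<Longrightarrow> nonneg_coeffs G \<Longrightarrow> nonneg_coeffs (F * G)"
  unfolding nonneg_coeffs_def fps_mult_nth by (intro allI nonneg_Reals_sum nonneg_Reals_mult_I) auto

lemma nonneg_coeffs_add: "nonneg_coeffs F \<Longrightarrow> nonneg_coeffs G \<Longrightarrow> nonneg_coeffs (F + G)"
  unfolding nonneg_coeffs_def by (auto intro: nonneg_Reals_add_I)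

lemma nonneg_coeffs_deriv: "nonneg_coeffs F \<Longrightarrow> nonneg_coeffs (fps_deriv F)"
  unfolding nonneg_coeffs_def fps_deriv_nth by (intro allI nonneg_Reals_mult_I) auto

lemma nonneg_coeffs_norm_le:
  assumes exp: "q has_fps_expansion Q" and "q holomorphic_on ball 0 1" and Q: "nonneg_coeffs Q"
    and z: "z \<in> ball 0 1"
  shows "norm (q z) \<le> Re (q (of_real (norm z)))"
proof -
  have holo: "q holomorphic_on eball 0 1" using assms(2) by (simp add: one_ereal_def)
  have *: "ereal (norm z) < 1" "ereal (norm (complex_of_real (norm z))) < 1"
    using z by (simp_all add: one_ereal_def)
  define c where "c = (\<lambda>n. Re (fps_nth Q n))"
  have c: "fps_nth Q n = of_real (c n)" "c n \<ge> 0" for n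
    using Q by (auto simp: nonneg_coeffs_def c_def complex_nonneg_Reals_iff complex_eq_iff)
  have s1: "(\<lambda>n. fps_nth Q n * z ^ n) sums q z"
    by (rule has_fps_expansion_imp_sums_complex[OF exp holo *(1)])
  have "(\<lambda>n. fps_nth Q n * of_real (norm z) ^ n) sums q (of_real (norm z))"
    by (rule has_fps_expansion_imp_sums_complex[OF exp holo *(2)])
  from sums_Re[OF this] have s2: "(\<lambda>n. c n * norm z ^ n) sums Re (q (of_real (norm z)))"
    by (simp add: c flip: of_real_power)
  have "norm (\<Sum>n. fps_nth Q n * z ^ n) \<le> (\<Sum>n. c n * norm z ^ n)"
    using s2 by (intro norm_suminf_le) (auto simp: norm_mult norm_power c sums_iff)
  then show ?thesis using s1 s2 by (simp add: sums_iff)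
qed

section \<open>The power series of the normalized Bessel function\<close>

definition bessel_coeff :: "real \<Rightarrow> nat \<Rightarrow> real" where
  "bessel_coeff c n = (-1) ^ n / (4 ^ n * fact n * pochhammer c n)"

text \<open>
  The hypergeometric series \<open>0F1(; c; - z / 4)\<close>. With \<open>c = \<nu> + 1\<close> the normalized Bessel function is
  \<open>z\<close> times this series.
\<close>

definition bessel_fps :: "real \<Rightarrow> complex fps" where
  "bessel_fps c = Abs_fps (\<lambda>n. of_real (bessel_coeff c n))"

lemma fps_nth_bessel_fps [simp]: "fps_nth (bessel_fps c) n = of_real (bessel_coeff c n)"
  by (simp add: bessel_fps_def)

lemma bessel_coeff_0 [simp]: "bessel_coeff c 0 = 1"
  by (simp add: bessel_coeff_def)

lemma bessel_coeff_Gamma: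
  assumes "c > 0"
  shows "of_real (bessel_coeff c n)
           = (-1) ^ n * Gamma (of_real c) / (4 ^ n * fact n * Gamma (of_real c + of_nat n :: complex))"
proof -
  have c: "complex_of_real c \<notin> \<int>\<^sub>\<le>\<^sub>0"
    using assms by (auto elim!: nonpos_Ints_cases simp: complex_eq_iff)
  have "of_real (pochhammer c n) = pochhammer (complex_of_real c) n"
    by (simp add: pochhammer_of_real)
  also have "\<dots> = Gamma (of_real c + of_nat n) / Gamma (of_real c)"
    by (rule pochhammer_Gamma[OF c])
  finally show ?thesis
    by (simp add: bessel_coeff_def)
qed

lemma bessel_series_summable:
  assumes "c > 0"
  shows "summable (\<lambda>n. of_real (bessel_coeff c n) * z ^ n :: complex)"
proof -
  have "summable (\<lambda>n. Gamma (of_real c) *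
          ((-1) ^ n * z ^ n / (4 ^ n * fact n * Gamma (of_real (c - 1) + of_nat n + 1))))"
    using assms by (intro summable_mult Bessel_series_summable) simp
  moreover have "complex_of_real (c - 1) + of_nat n + 1 = of_real c + of_nat n" for n
    by simp
  ultimately show ?thesis
    unfolding bessel_coeff_Gamma[OF assms] by (simp add: mult_ac)
qed

lemma fps_conv_radius_bessel_fps [simp]: "c > 0 \<Longrightarrow> fps_conv_radius (bessel_fps c) = \<infinity>"
  unfolding fps_conv_radius_def using bessel_series_summable
  by (intro conv_radius_inftyI'') simp

lemma fps_conv_radius_X_bessel_fps: "c > 0 \<Longrightarrow> fps_conv_radius (fps_X * bessel_fps c) = \<infinity>"
  using fps_conv_radius_mult[of fps_X "bessel_fps c"] by simp

lemma normalized_Bessel_eq_eval_fps: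
  assumes "\<nu> > -1"
  shows "normalized_Bessel \<nu> = eval_fps (fps_X * bessel_fps (\<nu> + 1))"
proof
  fix z
  have G: "of_real \<nu> + of_nat n + 1 = of_real (\<nu> + 1) + (of_nat n :: complex)" for n
    by simp
  have "normalized_Bessel \<nu> z = (\<Sum>n. z * (of_real (bessel_coeff (\<nu> + 1) n) * z ^ n))"
    unfolding normalized_Bessel_def G using assms
    by (simp add: bessel_coeff_Gamma mult_ac)
  also have "\<dots> = z * (\<Sum>n. of_real (bessel_coeff (\<nu> + 1) n) * z ^ n)"
    using assms by (intro suminf_mult bessel_series_summable) simp
  also have "\<dots> = eval_fps (fps_X * bessel_fps (\<nu> + 1)) z"
    using assms by (subst eval_fps_mult) (simp_all add: eval_fps_def[of "bessel_fps _"])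
  finally show "normalized_Bessel \<nu> z = eval_fps (fps_X * bessel_fps (\<nu> + 1)) z" .
qed

lemma fps_conv_radius_deriv_infinity [simp]:
  fixes P :: "complex fps"
  shows "fps_conv_radius P = \<infinity> \<Longrightarrow> fps_conv_radius (fps_deriv P) = \<infinity>"
  using fps_conv_radius_deriv[of P] by simp

lemma fps_conv_radius_funpow_deriv:
  fixes P :: "complex fps"
  shows "fps_conv_radius P = \<infinity> \<Longrightarrow> fps_conv_radius ((fps_deriv ^^ k) P) = \<infinity>"
  by (induction k) auto

lemma funpow_deriv_eval_fps:
  fixes P :: "complex fps"
  assumes "fps_conv_radius P = \<infinity>"
  shows "(deriv ^^ k) (eval_fps P) = eval_fps ((fps_deriv ^^ k) P)"
proof (induction k)
  case (Suc k)
  have "deriv (eval_fps ((fps_deriv ^^ k) P)) = eval_fps (fps_deriv ((fps_deriv ^^ k) P))"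
    using fps_conv_radius_funpow_deriv[OF assms, of k] by (intro ext eval_fps_deriv[symmetric]) simp
  then show ?case by (simp add: Suc)
qed simp

lemma fps_nth_funpow_deriv:
  fixes P :: "complex fps"
  shows "fps_nth ((fps_deriv ^^ k) P) n = fact (n + k) / fact n * fps_nth P (n + k)"
proof (induction k arbitrary: n)
  case (Suc k)
  have "fps_nth ((fps_deriv ^^ Suc k) P) n
      = of_nat (Suc n) * (fact (Suc n + k) / fact (Suc n) * fps_nth P (Suc n + k))"
    by (simp only: funpow.simps o_apply fps_deriv_nth Suc) (simp only: Suc_eq_plus1)
  moreover have "of_nat (Suc n) * (fact (Suc n + k) / fact (Suc n)) = (fact (n + Suc k) / fact n :: complex)"
    unfolding fact_Suc[of n] by (simp add: divide_simps del: of_nat_Suc)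
  ultimately show ?case by (metis add_Suc_shift mult.assoc)
qed simp

lemma pochhammer_mono:
  fixes x y :: real
  assumes "0 < x" and "x \<le> y"
  shows "pochhammer x n \<le> pochhammer y n"
  unfolding pochhammer_prod using assms by (intro prod_mono) auto

text \<open>
  For \<open>k \<ge> 1\<close> and every \<open>c > 0\<close> the coefficients \<open>p\<^sub>n\<close> of the \<open>k\<close>-th derivative satisfy
  \<open>(m + 1)\<^sup>2 \<bar>p\<^bsub>m+1\<^esub>\<bar> \<le> 3 / 4\<^sup>m * \<bar>p\<^sub>1\<bar>\<close> for \<open>m \<ge> 1\<close>, and the numbers \<open>3 / 4\<^sup>m\<close> add up to exactly 1. So only the
  function itself, and not its derivatives, restricts \<open>\<nu>\<close> in the theorem.
\<close>

lemma bessel_higher_derivatives_convex: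
  assumes c: "c > 0" and k: "k \<ge> 1"
  defines "P \<equiv> (fps_deriv ^^ k) (fps_X * bessel_fps c)"
  shows "convex_in_disk (eval_fps P)"
proof -
  have P: "norm (fps_nth P (m + 1)) = real (m + 1 + k) / (fact (m + 1) * 4 ^ (m + k) * pochhammer c (m + k))" for m
  proof -
    have "fps_nth P (m + 1) = fact (m + 1 + k) / fact (m + 1) * of_real (bessel_coeff c (m + k))"
      unfolding P_def fps_nth_funpow_deriv by simp
    also have "\<dots> = of_real (fact (m + 1 + k) / fact (m + 1) * bessel_coeff c (m + k))"
      by simp
    finally have "norm (fps_nth P (m + 1)) = \<bar>fact (m + 1 + k) / fact (m + 1) * bessel_coeff c (m + k)\<bar>"
      by (simp only: norm_of_real)
    also have "\<dots> = fact (m + 1 + k) / fact (m + 1) / (4 ^ (m + k) * fact (m + k) * pochhammer c (m + k))"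
      using pochhammer_pos[OF c, of "m + k"] by (simp add: bessel_coeff_def abs_mult power_abs)
    also have "fact (m + 1 + k) = real (m + 1 + k) * fact (m + k)"
      by (metis add.commute add_Suc_right fact_Suc plus_1_eq_Suc of_nat_fact of_nat_mult)
    finally show ?thesis by (simp add: mult_ac)
  qed
  have P1: "norm (fps_nth P 1) = real (1 + k) / (4 ^ k * pochhammer c k)"
    using P[of 0] by simp
  have nz: "fps_nth P 1 \<noteq> 0"
    using P1 pochhammer_pos[OF c, of k] by auto
  have bound: "(real m + 1)\<^sup>2 * norm (fps_nth P (m + 1)) \<le> 3 / 4 ^ m * norm (fps_nth P 1)"
    if m: "m \<ge> 1" for m
  proof -
    have fp: "fact m \<le> pochhammer (c + real k) m"
      unfolding pochhammer_fact using c k by (intro pochhammer_mono) auto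
    have pos: "pochhammer c k > 0" "pochhammer (c + real k) m > 0"
      using c by (auto intro: pochhammer_pos)
    have pk: "pochhammer c (m + k) = pochhammer c k * pochhammer (c + real k) m"
      using pochhammer_product'[of c k m] by (simp add: add.commute)
    have "(real m + 1)\<^sup>2 * norm (fps_nth P (m + 1))
       = (real m + 1) * (real (m + 1 + k) / real (1 + k)) / (fact m * 4 ^ m * pochhammer (c + real k) m)
         * norm (fps_nth P 1)"
    proof -
      have gen: "x\<^sup>2 * (y / (x * f * (q * p) * (A * B))) = x * (y / w) / (f * q * B) * (w / (p * A))"
        if "x \<noteq> 0" "w \<noteq> 0" "A \<noteq> 0" "B \<noteq> 0" "f \<noteq> 0" for x y w f p q A B :: real
        using that by (simp add: power2_eq_square)
      have "fact (m + 1) = (real m + 1) * fact m" by simp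
      then show ?thesis
        unfolding P P1 pk power_add using pos by (simp only:) (intro gen; simp)
    qed
    also have "\<dots> \<le> 3 / 4 ^ m * norm (fps_nth P 1)"
    proof (rule mult_right_mono)
      have "real (m + 1 + k) / real (1 + k) \<le> (real m + 2) / 2"
      proof -
        have "m * 1 \<le> m * k" using k by (intro mult_left_mono) auto
        then have "2 * (m + 1 + k) \<le> (m + 2) * (1 + k)" by (simp add: algebra_simps)
        then have "2 * real (m + 1 + k) \<le> (real m + 2) * real (1 + k)"
          by (metis (mono_tags, lifting) of_nat_add of_nat_le_iff of_nat_mult of_nat_numeral)
        then show ?thesis by (simp add: divide_simps mult.commute)
      qed
      then have "(real m + 1) * (real (m + 1 + k) / real (1 + k)) \<le> (real m + 1) * ((real m + 2) / 2)"
        by (intro mult_left_mono) auto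
      also have "\<dots> \<le> 3 * (real m * real m)"
      proof -
        \<comment> \<open>The difference of the two sides is half of this product.\<close>
        have "0 \<le> (5 * real m + 2) * (real m - 1)" using m by simp
        then show ?thesis by (simp add: algebra_simps)
      qed
      also have "\<dots> \<le> 3 * (fact m * pochhammer (c + real k) m)"
      proof -
        have "real m \<le> fact m" by (metis fact_ge_self of_nat_fact of_nat_le_iff)
        then show ?thesis using fp by (intro mult_left_mono mult_mono) auto
      qed
      finally show "(real m + 1) * (real (m + 1 + k) / real (1 + k)) / (fact m * 4 ^ m * pochhammer (c + real k) m)
          \<le> 3 / 4 ^ m"
        using pos by (simp add: divide_simps mult_ac)
    qed simp
    finally show ?thesis .
  qed
  have geo: "(\<lambda>n. 3 / 4 ^ Suc n * norm (fps_nth P 1)) sums norm (fps_nth P 1)"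
  proof -
    have "(\<lambda>n. (1/4 :: real) ^ n) sums (1 / (1 - 1/4))" by (rule geometric_sums) simp
    from sums_mult[OF this, of "3 / 4 * norm (fps_nth P 1)"] show ?thesis
      by (simp add: power_divide)
  qed
  have b: "(real n + 2)\<^sup>2 * norm (fps_nth P (n + 2)) \<le> 3 / 4 ^ Suc n * norm (fps_nth P 1)" for n
    using bound[of "Suc n"] by (simp add: add.commute)
  have summ: "summable (\<lambda>n. (real n + 2)\<^sup>2 * norm (fps_nth P (n + 2)))"
    by (rule summable_comparison_test'[OF sums_summable[OF geo]]) (use b in simp)
  have le: "(\<Sum>n. (real n + 2)\<^sup>2 * norm (fps_nth P (n + 2))) \<le> norm (fps_nth P 1)"
    using suminf_le[OF b summ sums_summable[OF geo]] sums_unique[OF geo] by simp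
  have rad: "fps_conv_radius P \<ge> 1"
    unfolding P_def using fps_conv_radius_funpow_deriv[OF fps_conv_radius_X_bessel_fps[OF c], of k] by simp
  show ?thesis
    by (rule convex_in_disk_coefficient_criterion[OF rad nz summ le])
qed

section \<open>Positivity of logarithmic derivatives\<close>

lemma bessel_coeff_Suc: "bessel_coeff c (Suc n) = - bessel_coeff c n / (4 * real (Suc n) * (c + real n))"
  by (simp add: bessel_coeff_def pochhammer_Suc mult_ac)

lemma fps_deriv_bessel_fps:
  assumes "c > 0"
  shows "fps_deriv (bessel_fps c) = - fps_const (of_real (1 / (4 * c))) * bessel_fps (c + 1)"
proof (rule fps_ext)
  fix n
  have "real (Suc n) * bessel_coeff c (Suc n) = - (1 / (4 * c)) * bessel_coeff (c + 1) n"
    by (simp add: bessel_coeff_def pochhammer_rec[of c n] mult_ac del: of_nat_Suc)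
  then have "of_real (real (Suc n) * bessel_coeff c (Suc n))
      = (of_real (- (1 / (4 * c)) * bessel_coeff (c + 1) n) :: complex)" by (rule arg_cong)
  then show "fps_nth (fps_deriv (bessel_fps c)) n
      = fps_nth (- fps_const (of_real (1 / (4 * c))) * bessel_fps (c + 1)) n"
    by (simp del: of_nat_Suc)
qed

lemma bessel_fps_contiguous:
  assumes "c > 0"
  shows "bessel_fps (c + 1) = bessel_fps c + fps_const (of_real (1 / (4 * c * (c + 1)))) * fps_X * bessel_fps (c + 2)"
proof (rule fps_ext)
  fix n
  have "bessel_coeff (c + 1) n = bessel_coeff c n + (if n = 0 then 0 else 1 / (4 * c * (c + 1)) * bessel_coeff (c + 2) (n - 1))"
  proof (cases n)
    case (Suc m)
    define p where "p = pochhammer (c + 2) m"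
    have p: "p > 0" unfolding p_def using assms by (intro pochhammer_pos) simp
    have 1: "pochhammer c (Suc m) * (c + real m + 1) = c * (c + 1) * p"
      unfolding p_def using pochhammer_rec[of c "Suc m"] pochhammer_rec[of "c + 1" m] pochhammer_Suc[of c "Suc m"]
      by (simp add: algebra_simps)
    have 2: "pochhammer (c + 1) (Suc m) = (c + 1) * p"
      unfolding p_def using pochhammer_rec[of "c + 1" m] by (simp add: algebra_simps)
    have 3: "pochhammer c (Suc m) = c * (c + 1) * p / (c + real m + 1)"
      using 1 assms by (simp add: eq_divide_eq)
    define K :: real where "K = (-1) ^ Suc m / (4 ^ Suc m * fact (Suc m))"
    have "bessel_coeff (c + 1) n = K * (1 / ((c + 1) * p))"
      unfolding bessel_coeff_def Suc 2 K_def by simp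
    moreover have "bessel_coeff c n = K * ((c + real m + 1) / (c * (c + 1) * p))"
      unfolding bessel_coeff_def Suc 3 K_def by simp
    ultimately have "bessel_coeff (c + 1) n - bessel_coeff c n
       = K * (1 / ((c + 1) * p) - (c + real m + 1) / (c * (c + 1) * p))"
      by (simp only: right_diff_distrib)
    also have "1 / ((c + 1) * p) - (c + real m + 1) / (c * (c + 1) * p) = - real (Suc m) / (c * (c + 1) * p)"
      using p assms by (simp add: divide_simps)
    also have "K * (- real (Suc m) / (c * (c + 1) * p))
       = 1 / (4 * c * (c + 1)) * bessel_coeff (c + 2) m"
      unfolding K_def bessel_coeff_def p_def[symmetric] fact_Suc using p assms
      by (simp add: divide_simps del: of_nat_Suc)
    finally show ?thesis using Suc by simp
  qed simp
  then have "complex_of_real (bessel_coeff (c + 1) n) = of_real (bessel_coeff c n + (if n = 0 then 0 else 1 / (4 * c * (c + 1)) * bessel_coeff (c + 2) (n - 1)))"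
    by (rule arg_cong)
  then show "fps_nth (bessel_fps (c + 1)) n
      = fps_nth (bessel_fps c + fps_const (of_real (1 / (4 * c * (c + 1)))) * fps_X * bessel_fps (c + 2)) n"
    by (simp add: mult.assoc)
qed

text \<open>
  The quotient \<open>0F1(; c + 1; - z / 4) / 0F1(; c; - z / 4)\<close>, that is, up to the factor \<open>sqrt z / (2 c)\<close>, the
  quotient \<open>J\<^bsub>\<nu>+1\<^esub> / J\<^sub>\<nu>\<close> at \<open>sqrt z\<close> for \<open>\<nu> = c - 1\<close>, whose continued fraction has positive coefficients.
\<close>

definition bessel_ratio_fps :: "real \<Rightarrow> complex fps" where
  "bessel_ratio_fps c = bessel_fps (c + 1) * inverse (bessel_fps c)"

lemma bessel_fps_inverse: "bessel_fps c * inverse (bessel_fps c) = 1"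
  by (rule inverse_mult_eq_1') simp

text \<open>
  One step \<open>R\<^sub>c = 1 / (1 - z / (4 c (c + 1)) R\<^bsub>c+1\<^esub>)\<close> of that continued fraction.
\<close>

lemma bessel_ratio_fps_renewal:
  assumes "c > 0"
  shows "bessel_ratio_fps c
    = 1 + (fps_const (of_real (1 / (4 * c * (c + 1)))) * fps_X * bessel_ratio_fps (c + 1)) * bessel_ratio_fps c"
proof -
  let ?K = "fps_const (of_real (1 / (4 * c * (c + 1)))) * fps_X :: complex fps"
  have "bessel_ratio_fps (c + 1) * bessel_ratio_fps c
      = bessel_fps (c + 2) * inverse (bessel_fps c) * (bessel_fps (c + 1) * inverse (bessel_fps (c + 1)))"
    by (simp add: bessel_ratio_fps_def mult_ac add.assoc)
  then have *: "bessel_ratio_fps (c + 1) * bessel_ratio_fps c = bessel_fps (c + 2) * inverse (bessel_fps c)"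
    by (simp add: bessel_fps_inverse)
  have "bessel_ratio_fps c = (bessel_fps c + ?K * bessel_fps (c + 2)) * inverse (bessel_fps c)"
    unfolding bessel_ratio_fps_def by (subst bessel_fps_contiguous[OF assms]) (rule refl)
  also have "\<dots> = 1 + ?K * (bessel_fps (c + 2) * inverse (bessel_fps c))"
    by (simp add: distrib_right bessel_fps_inverse mult.assoc)
  finally show ?thesis unfolding *[symmetric] by (simp only: mult.assoc)
qed

text \<open>
  The factor \<open>z\<close> in the continued fraction step shifts the index, so the \<open>n\<close>-th coefficient for \<open>c\<close>
  depends only on coefficients for \<open>c + 1\<close> of smaller index. Hence the induction on \<open>n\<close> with \<open>c\<close>
  arbitrary.
\<close>

lemma nonneg_coeffs_bessel_ratio_fps:
  assumes "c > 0"
  shows "nonneg_coeffs (bessel_ratio_fps c)"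
proof -
  have "fps_nth (bessel_ratio_fps c) n \<in> \<real>\<^sub>\<ge>\<^sub>0" for n
    using assms
  proof (induction n arbitrary: c rule: less_induct)
    case (less n)
    let ?U = "fps_const (of_real (1 / (4 * c * (c + 1)))) * fps_X * bessel_ratio_fps (c + 1)"
    have U: "fps_nth ?U i = (if i = 0 then 0 else of_real (1 / (4 * c * (c + 1))) * fps_nth (bessel_ratio_fps (c + 1)) (i - 1))" for i
      by (simp add: mult.assoc)
    show ?case
    proof (rule nonneg_coeffs_renewal[OF bessel_ratio_fps_renewal[OF less.prems]])
      show "fps_nth ?U i \<in> \<real>\<^sub>\<ge>\<^sub>0" if "i \<le> n" for i
      proof (cases "i = 0")
        case False
        have "fps_nth (bessel_ratio_fps (c + 1)) (i - 1) \<in> \<real>\<^sub>\<ge>\<^sub>0"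
          using False that less.prems by (intro less.IH) auto
        moreover have "complex_of_real (1 / (4 * c * (c + 1))) \<in> \<real>\<^sub>\<ge>\<^sub>0"
          unfolding nonneg_Reals_of_real_iff using less.prems by simp
        ultimately show ?thesis unfolding U using False by (simp del: of_real_divide)
      qed (simp add: U)
    qed (simp add: U)
  qed
  then show ?thesis by (simp add: nonneg_coeffs_def)
qed

lemma nonneg_coeffs_bessel_log_deriv:
  assumes "c > 0"
  shows "nonneg_coeffs (- fps_deriv (bessel_fps c) * inverse (bessel_fps c))"
proof -
  have "- fps_deriv (bessel_fps c) * inverse (bessel_fps c) = fps_const (of_real (1 / (4 * c))) * bessel_ratio_fps c"
    unfolding fps_deriv_bessel_fps[OF assms] bessel_ratio_fps_def
    by (simp only: mult_minus_left minus_minus mult.assoc)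
  moreover have "nonneg_coeffs (fps_const (of_real (1 / (4 * c))))"
    unfolding nonneg_coeffs_def using assms by (auto simp del: of_real_divide of_real_mult)
  ultimately show ?thesis
    using nonneg_coeffs_mult nonneg_coeffs_bessel_ratio_fps[OF assms] by metis
qed

text \<open>
  The derivative factors as \<open>D = B (1 - U)\<close> with \<open>U = z / (4 c) R\<^sub>c\<close>, so \<open>- D' / D\<close> is the sum of
  \<open>- B' / B\<close> and \<open>U' / (1 - U)\<close>, and both have nonnegative coefficients because \<open>R\<^sub>c\<close> has.
\<close>

lemma nonneg_coeffs_bessel_deriv_log_deriv:
  assumes "c > 0"
  defines "D \<equiv> fps_deriv (fps_X * bessel_fps c)"
  shows "nonneg_coeffs (- fps_deriv D * inverse D)"
proof -
  define B where "B = bessel_fps c"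
  define U where "U = fps_const (of_real (1 / (4 * c))) * fps_X * bessel_ratio_fps c"
  define V where "V = inverse (1 - U)"
  have U0: "fps_nth U 0 = 0" by (simp add: U_def mult.assoc)
  have BB: "B * inverse B = 1" unfolding B_def by (rule bessel_fps_inverse)
  have UV: "(1 - U) * V = 1" unfolding V_def by (rule inverse_mult_eq_1') (simp add: U0)
  have D: "D = B * (1 - U)"
  proof -
    have "B * U = (B * inverse B) * (fps_const (of_real (1 / (4 * c))) * fps_X * bessel_fps (c + 1))"
      unfolding U_def bessel_ratio_fps_def B_def by (simp only: mult_ac)
    also have "\<dots> = - fps_X * fps_deriv B"
      unfolding BB unfolding B_def fps_deriv_bessel_fps[OF assms(1)]
      by (simp only: mult_1_left mult_minus_left mult_minus_right minus_minus mult_ac)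
    finally show ?thesis
      unfolding D_def B_def[symmetric] by (simp add: algebra_simps)
  qed
  have "inverse D = inverse B * V"
    unfolding D V_def by (rule fps_inverse_mult)
  then have "- fps_deriv D * inverse D = - (fps_deriv B * inverse B) * ((1 - U) * V) + (B * inverse B) * (fps_deriv U * V)"
    unfolding D by (simp add: algebra_simps)
  then have eq: "- fps_deriv D * inverse D = - fps_deriv B * inverse B + fps_deriv U * V"
    unfolding UV BB by simp
  have const: "nonneg_coeffs (fps_const (of_real (1 / (4 * c))))"
    unfolding nonneg_coeffs_def using assms by (auto simp del: of_real_divide of_real_mult)
  have "nonneg_coeffs U"
    unfolding U_def by (intro nonneg_coeffs_mult const nonneg_coeffs_bessel_ratio_fps assms) (auto simp: nonneg_coeffs_def fps_X_nth)
  moreover from this have "nonneg_coeffs V"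
  proof -
    have "V = 1 + U * V" using UV by (simp add: algebra_simps)
    then show ?thesis
      using nonneg_coeffs_renewal[OF _ U0] \<open>nonneg_coeffs U\<close> by (simp add: nonneg_coeffs_def)
  qed
  ultimately show ?thesis
    unfolding eq B_def
    by (intro nonneg_coeffs_add nonneg_coeffs_mult nonneg_coeffs_deriv nonneg_coeffs_bessel_log_deriv[OF assms(1)])
qed

text \<open>
  If \<open>- F' / F\<close> has nonnegative coefficients, then \<open>- z F' / F\<close> is, on each circle, largest in modulus on the positive
  axis. This replaces a Hadamard product of \<open>F\<close> over positive zeros, for which the
  coefficients of \<open>- F' / F\<close> would be the power sums of the reciprocals of the zeros.
\<close>

lemma Re_log_deriv_ge:
  assumes rad: "fps_conv_radius F = \<infinity>" and F0: "fps_nth F 0 \<noteq> 0"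
    and nz: "\<And>z. z \<in> ball 0 1 \<Longrightarrow> eval_fps F z \<noteq> 0"
    and nonneg: "nonneg_coeffs (- fps_deriv F * inverse F)" and z: "z \<in> ball 0 1"
  defines "q \<equiv> \<lambda>z. z * eval_fps (fps_deriv F) z / eval_fps F z"
  shows "Re (q z) \<ge> Re (q (of_real (norm z)))"
proof -
  define h where "h = (\<lambda>z. - eval_fps (fps_deriv F) z * inverse (eval_fps F z))"
  have "h has_fps_expansion (- fps_deriv F * inverse F)"
    unfolding h_def using F0 rad
    by (intro fps_expansion_intros eval_fps_has_fps_expansion) auto
  moreover have "h holomorphic_on ball 0 1"
    unfolding h_def using nz rad by (intro holomorphic_intros) auto
  ultimately have "norm (h z) \<le> Re (h (of_real (norm z)))"
    using nonneg z by (rule nonneg_coeffs_norm_le)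
  then have le: "norm (z * h z) \<le> norm z * Re (h (of_real (norm z)))"
    by (simp add: norm_mult mult_left_mono)
  have q: "q z = - (z * h z)" for z by (simp add: q_def h_def divide_inverse)
  have "Re (z * h z) \<le> norm z * Re (h (of_real (norm z)))"
    using le complex_Re_le_cmod[of "z * h z"] by linarith
  also have "\<dots> = - Re (q (of_real (norm z)))" by (simp add: q)
  finally show ?thesis by (simp add: q)
qed

section \<open>Monotonicity on the real axis and in the order\<close>

text \<open>
  The value at \<open>x\<close> of the \<open>p\<close>-fold application of \<open>g \<mapsto> (z g)'\<close> to the series \<open>B\<^sub>c\<close>. With \<open>f = z B\<^sub>c\<close>
  these are \<open>f / z\<close>, \<open>f'\<close> and \<open>(z f')'\<close> for \<open>p\<close> equal to 0, 1 and 2.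
\<close>

definition bessel_sum :: "nat \<Rightarrow> real \<Rightarrow> real \<Rightarrow> real" where
  "bessel_sum p c x = (\<Sum>n. real (Suc n) ^ p * bessel_coeff c n * x ^ n)"

text \<open>
  In all series below the term of index 1 dominates the sum of the later ones: the
  growth condition on \<open>y\<close> bounds the term of index \<open>n + 2\<close> by \<open>9/16 * (1/4)\<^sup>n\<close> times the size
  \<open>2\<^sup>p u / 4\<close> of the term of index 1, and these factors add up to \<open>3/4 < 1\<close>. The lemma is applied to
  \<open>y\<^sub>n = (s\<^sup>n - r\<^sup>n) / (c)\<^sub>n\<close> and to \<open>y\<^sub>n = 1 / (c)\<^sub>n - 1 / (c')\<^sub>n\<close>, which gives the monotonicity in the
  argument and in \<open>c\<close>; convergence itself is the case \<open>y\<^sub>n = x\<^sup>n / (c)\<^sub>n\<close>.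
\<close>

lemma weighted_alternating_series:
  fixes y :: "nat \<Rightarrow> real"
  assumes p: "p \<le> 2" and y: "\<And>n. \<bar>y (Suc n)\<bar> \<le> real (Suc n) * u / fact n"
  defines "t \<equiv> \<lambda>n. real (Suc n) ^ p * ((-1) ^ n / (4 ^ n * fact n) * y n)"
  shows weighted_alternating_series_summable: "summable t"
    and weighted_alternating_series_neg: "y 0 = 0 \<Longrightarrow> y 1 = u \<Longrightarrow> u > 0 \<Longrightarrow> suminf t < 0"
    and weighted_alternating_series_bound: "y 0 = 0 \<Longrightarrow> y 1 = u \<Longrightarrow> \<bar>suminf t\<bar> \<le> 2 ^ p * u"
proof -
  have u: "u \<ge> 0" using y[of 0] by simp
  have bound: "\<bar>t (n + 2)\<bar> \<le> 2 ^ p * u / 4 * (9 / 16 * (1 / 4) ^ n)" for n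
  proof -
    have w: "real (n + 3) ^ p \<le> 2 ^ p * (real (n + 3))\<^sup>2 / 4"
    proof -
      \<comment> \<open>The weight relative to the one of index 1 is largest for \<open>p = 2\<close>.\<close>
      have "(real (n + 3) / 2) ^ p \<le> (real (n + 3) / 2)\<^sup>2"
        using p by (intro power_increasing) auto
      then show ?thesis by (simp add: power_divide divide_le_eq mult.commute)
    qed
    have f3: "real (n + 3) \<le> 3 * fact (n + 1)"
    proof -
      have "real (n + 1) \<le> fact (n + 1)" by (metis fact_ge_self of_nat_fact of_nat_le_iff)
      then show ?thesis by linarith
    qed
    have "\<bar>t (n + 2)\<bar> = real (n + 3) ^ p / (4 ^ (n + 2) * fact (n + 2)) * \<bar>y (n + 2)\<bar>"
      unfolding t_def by (simp add: abs_mult power_abs add.commute del: fact_Suc)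
    also have "\<dots> \<le> (2 ^ p * (real (n + 3))\<^sup>2 / 4) / (4 ^ (n + 2) * fact (n + 2)) * (real (n + 2) * u / fact (n + 1))"
      using y[of "n + 1"] w by (intro mult_mono divide_right_mono) auto
    also have "\<dots> = 2 ^ p * u / 4 * ((real (n + 3) / fact (n + 1))\<^sup>2 / 4 ^ (n + 2))"
    proof -
      have "fact (n + 2) = real (n + 2) * fact (n + 1)" by simp
      then show ?thesis by (simp only:) (simp add: power2_eq_square mult_ac del: fact_Suc of_nat_Suc of_nat_add)
    qed
    also have "\<dots> \<le> 2 ^ p * u / 4 * (3\<^sup>2 / 4 ^ (n + 2))"
      using f3 u by (intro mult_left_mono divide_right_mono power_mono) (simp_all add: divide_le_eq del: fact_Suc)
    also have "\<dots> = 2 ^ p * u / 4 * (9 / 16 * (1 / 4) ^ n)"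
      by (simp add: power_divide)
    finally show ?thesis .
  qed
  have geo: "(\<lambda>n. 2 ^ p * u / 4 * (9 / 16 * (1 / 4) ^ n)) sums (2 ^ p * u / 4 * (9 / 16 * (1 / (1 - 1 / 4))))"
    by (intro sums_mult geometric_sums) simp
  have s2: "summable (\<lambda>n. t (n + 2))"
    by (rule summable_comparison_test'[OF sums_summable[OF geo]]) (use bound in simp)
  then show summ: "summable t" using summable_iff_shift[of t 2] by blast
  have tail: "\<bar>\<Sum>n. t (n + 2)\<bar> \<le> 2 ^ p * u / 4 * (3 / 4)"
    using norm_suminf_le[OF _ sums_summable[OF geo], of "\<lambda>n. t (n + 2)"] bound sums_unique[OF geo] by simp
  have split: "suminf t = - (2 ^ p * u / 4) + (\<Sum>n. t (n + 2))" if "y 0 = 0" "y 1 = u"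
  proof -
    have "suminf t = (\<Sum>n. t (n + 2)) + (\<Sum>i<2. t i)"
      by (rule suminf_split_initial_segment[OF summ])
    also have "(\<Sum>i<2. t i) = - (2 ^ p * u / 4)"
      using that by (simp add: t_def numeral_2_eq_2)
    finally show ?thesis by simp
  qed
  show "suminf t < 0" if "y 0 = 0" "y 1 = u" "u > 0"
  proof -
    have "2 ^ p * u / 4 * (3 / 4) < 2 ^ p * u / 4" using that(3) by simp
    then show ?thesis using tail split[OF that(1,2)] by linarith
  qed
  show "\<bar>suminf t\<bar> \<le> 2 ^ p * u" if "y 0 = 0" "y 1 = u"
  proof -
    have "0 \<le> 2 ^ p * u" using u by simp
    then show ?thesis using tail split[OF that] by linarith
  qed
qed

lemma inverse_pochhammer_le:
  fixes c :: real
  assumes "c > 0"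
  shows "1 / pochhammer c (Suc n) \<le> (1 / c) / fact n"
proof -
  have "c * fact n \<le> c * pochhammer (c + 1) n"
    unfolding pochhammer_fact using assms by (intro mult_left_mono pochhammer_mono) auto
  then show ?thesis
    unfolding pochhammer_rec using assms by (simp add: frac_le)
qed

text \<open>
  Of the factors of the Pochhammer symbol only \<open>c\<close> itself can be close to 0. The estimate is relative to
  the difference of \<open>1 / c\<close> and \<open>1 / c'\<close>, which absorbs this factor and makes it uniform in \<open>c > 0\<close>.
\<close>

lemma inverse_pochhammer_diff_le:
  fixes c c' :: real
  assumes "0 < c" and "c \<le> c'"
  shows "1 / pochhammer c (Suc n) - 1 / pochhammer c' (Suc n) \<le> real (Suc n) * (1 / c - 1 / c') / fact n"
proof (induction n)
  case (Suc n)
  define m where "m = real (Suc n)"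
  have m: "m > 0" "m \<ge> 1" by (auto simp: m_def)
  define A where "A = 1 / pochhammer c (Suc n)"
  define A' where "A' = 1 / pochhammer c' (Suc n)"
  define u where "u = 1 / c - 1 / c'"
  have c': "c' > 0" using assms by simp
  have u: "u \<ge> 0" using assms by (simp add: u_def frac_le)
  have IH: "A - A' \<le> m * u / fact n" using Suc unfolding A_def A'_def u_def m_def .
  have A'_le: "A' \<le> 1 / c' / fact n" unfolding A'_def by (rule inverse_pochhammer_le[OF c'])
  have "1 / pochhammer c (Suc (Suc n)) - 1 / pochhammer c' (Suc (Suc n))
      = (A - A') / (c + m) + A' * (1 / (c + m) - 1 / (c' + m))"
  proof -
    have "A / (c + m) - A' / (c' + m) = (A - A') / (c + m) + A' * (1 / (c + m) - 1 / (c' + m))"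
      by (simp add: diff_divide_distrib right_diff_distrib)
    then show ?thesis
      unfolding pochhammer_Suc[of _ "Suc n"] A_def A'_def m_def by simp
  qed
  also have "\<dots> \<le> (m * u / fact n) / m + (1 / c' / fact n) * ((c' - c) / (c * m))"
  proof (intro add_mono mult_mono)
    have "(A - A') / (c + m) \<le> (m * u / fact n) / (c + m)"
      using IH assms m by (intro divide_right_mono) auto
    also have "\<dots> \<le> (m * u / fact n) / m"
      using assms m u by (intro divide_left_mono) auto
    finally show "(A - A') / (c + m) \<le> (m * u / fact n) / m" .
    have "1 / (c + m) - 1 / (c' + m) = (c' - c) / ((c + m) * (c' + m))"
      using assms m by (simp add: divide_simps)
    also have "\<dots> \<le> (c' - c) / (c * m)"
      using assms m by (intro divide_left_mono mult_mono) auto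
    finally show "1 / (c + m) - 1 / (c' + m) \<le> (c' - c) / (c * m)" .
    show "0 \<le> 1 / (c + m) - 1 / (c' + m)"
      using assms m by (simp add: frac_le)
  qed (use A'_le c' in auto)
  also have "\<dots> = (m + 1) * u / (m * fact n)"
    unfolding u_def using m assms c' by (simp add: divide_simps) (simp add: algebra_simps)
  also have "\<dots> = real (Suc (Suc n)) * (1 / c - 1 / c') / fact (Suc n)"
    by (simp add: m_def u_def add.commute)
  finally show ?case .
qed simp

lemma bessel_sum_term:
  "real (Suc n) ^ p * bessel_coeff c n * x ^ n
     = real (Suc n) ^ p * ((-1) ^ n / (4 ^ n * fact n) * (x ^ n / pochhammer c n))"
  by (simp add: bessel_coeff_def)

lemma summable_bessel_sum:
  assumes "p \<le> 2" and "c > 0" and "\<bar>x\<bar> \<le> 1"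
  shows "summable (\<lambda>n. real (Suc n) ^ p * bessel_coeff c n * x ^ n)"
  unfolding bessel_sum_term
proof (rule weighted_alternating_series_summable[OF assms(1)])
  fix n
  have pos: "pochhammer c (Suc n) > 0" by (rule pochhammer_pos[OF assms(2)])
  have "\<bar>x ^ Suc n / pochhammer c (Suc n)\<bar> = \<bar>x\<bar> ^ Suc n / pochhammer c (Suc n)"
    using pos by (simp only: abs_divide power_abs abs_of_pos)
  also have "\<dots> \<le> 1 / pochhammer c (Suc n)"
    using assms(3) pos by (intro divide_right_mono power_le_one) auto
  also have "\<dots> \<le> (1 / c) / fact n"
    by (rule inverse_pochhammer_le[OF assms(2)])
  also have "\<dots> \<le> real (Suc n) * (1 / c) / fact n"
    using assms(2) mult_right_mono[of 1 "real (Suc n)" "1 / c"] by (intro divide_right_mono) auto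
  finally show "\<bar>x ^ Suc n / pochhammer c (Suc n)\<bar> \<le> real (Suc n) * (1 / c) / fact n" .
qed

lemma bessel_sum_antimono_x:
  assumes p: "p \<le> 2" and c: "c > 0" and rs: "0 \<le> r" "r < s" "s \<le> 1"
  shows "bessel_sum p c s < bessel_sum p c r"
proof -
  define y where "y = (\<lambda>n. (s ^ n - r ^ n) / pochhammer c n)"
  have y: "\<bar>y (Suc n)\<bar> \<le> real (Suc n) * ((s - r) / c) / fact n" for n
  proof -
    have pos: "pochhammer c (Suc n) > 0" by (rule pochhammer_pos[OF c])
    have pw: "s ^ Suc n - r ^ Suc n \<le> real (Suc n) * (s - r)"
    proof -
      have "s ^ Suc n - r ^ Suc n = (s - r) * (\<Sum>i<Suc n. r ^ (Suc n - Suc i) * s ^ i)"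
        by (rule power_diff_sumr2)
      also have "\<dots> \<le> (s - r) * (\<Sum>i<Suc n. 1)"
        using rs by (intro mult_left_mono sum_mono mult_le_one power_le_one) auto
      finally show ?thesis by (simp add: mult.commute)
    qed
    have "r ^ Suc n \<le> s ^ Suc n" using rs by (intro power_mono) auto
    then have "\<bar>y (Suc n)\<bar> = (s ^ Suc n - r ^ Suc n) * (1 / pochhammer c (Suc n))"
      unfolding y_def using pos by simp
    also have "\<dots> \<le> (real (Suc n) * (s - r)) * ((1 / c) / fact n)"
      using pw rs pos by (intro mult_mono inverse_pochhammer_le c) auto
    finally show ?thesis by simp
  qed
  have sr: "summable (\<lambda>n. real (Suc n) ^ p * bessel_coeff c n * r ^ n)"
       "summable (\<lambda>n. real (Suc n) ^ p * bessel_coeff c n * s ^ n)"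
    using rs by (auto intro!: summable_bessel_sum p c simp del: of_nat_Suc)
  have "bessel_sum p c s - bessel_sum p c r
      = (\<Sum>n. real (Suc n) ^ p * bessel_coeff c n * s ^ n - real (Suc n) ^ p * bessel_coeff c n * r ^ n)"
    unfolding bessel_sum_def by (rule suminf_diff[OF sr(2,1)])
  also have "\<dots> = (\<Sum>n. real (Suc n) ^ p * ((-1) ^ n / (4 ^ n * fact n) * y n))"
    unfolding bessel_sum_term y_def by (simp only: diff_divide_distrib right_diff_distrib)
  also have "\<dots> < 0"
    using rs c by (intro weighted_alternating_series_neg[OF p y]) (auto simp: y_def)
  finally show ?thesis by simp
qed

lemma bessel_sum_diff_c:
  assumes p: "p \<le> 2" and c: "0 < c" "c < c'"
  shows bessel_sum_mono_c: "bessel_sum p c 1 < bessel_sum p c' 1"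
    and bessel_sum_lipschitz: "\<bar>bessel_sum p c 1 - bessel_sum p c' 1\<bar> \<le> 2 ^ p * \<bar>1 / c - 1 / c'\<bar>"
proof -
  define y where "y = (\<lambda>n. 1 / pochhammer c n - 1 / pochhammer c' n)"
  have c': "c' > 0" using c by simp
  have y: "\<bar>y (Suc n)\<bar> \<le> real (Suc n) * (1 / c - 1 / c') / fact n" for n
  proof -
    have "pochhammer c (Suc n) \<le> pochhammer c' (Suc n)" using c by (intro pochhammer_mono) auto
    then have "1 / pochhammer c' (Suc n) \<le> 1 / pochhammer c (Suc n)"
      using pochhammer_pos[OF c(1), of "Suc n"] by (intro frac_le) auto
    then show ?thesis
      unfolding y_def using inverse_pochhammer_diff_le[of c c' n] c by simp
  qed
  have sr: "summable (\<lambda>n. real (Suc n) ^ p * bessel_coeff c n * 1 ^ n)"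
       "summable (\<lambda>n. real (Suc n) ^ p * bessel_coeff c' n * 1 ^ n)"
    by (auto intro!: summable_bessel_sum p c c' simp del: of_nat_Suc power_one)
  have "bessel_sum p c 1 - bessel_sum p c' 1
      = (\<Sum>n. real (Suc n) ^ p * bessel_coeff c n * 1 ^ n - real (Suc n) ^ p * bessel_coeff c' n * 1 ^ n)"
    unfolding bessel_sum_def by (rule suminf_diff[OF sr])
  also have "\<dots> = (\<Sum>n. real (Suc n) ^ p * ((-1) ^ n / (4 ^ n * fact n) * y n))"
    unfolding bessel_sum_term y_def by (simp only: power_one right_diff_distrib)
  finally have eq: "bessel_sum p c 1 - bessel_sum p c' 1
      = (\<Sum>n. real (Suc n) ^ p * ((-1) ^ n / (4 ^ n * fact n) * y n))" .
  have u: "1 / c - 1 / c' > 0" using c by (simp add: frac_less2)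
  have "(\<Sum>n. real (Suc n) ^ p * ((-1) ^ n / (4 ^ n * fact n) * y n)) < 0"
    using u by (intro weighted_alternating_series_neg[OF p y]) (auto simp: y_def)
  then show "bessel_sum p c 1 < bessel_sum p c' 1" using eq by simp
  have "\<bar>\<Sum>n. real (Suc n) ^ p * ((-1) ^ n / (4 ^ n * fact n) * y n)\<bar> \<le> 2 ^ p * (1 / c - 1 / c')"
    using u by (intro weighted_alternating_series_bound[OF p y]) (auto simp: y_def)
  then show "\<bar>bessel_sum p c 1 - bessel_sum p c' 1\<bar> \<le> 2 ^ p * \<bar>1 / c - 1 / c'\<bar>"
    unfolding eq using u by simp
qed

text \<open>
  The value at 1 is a Lipschitz function of \<open>1 / c\<close>.
\<close>

lemma continuous_on_bessel_sum:
  assumes "p \<le> 2"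
  shows "continuous_on {0<..} (\<lambda>c. bessel_sum p c 1)"
proof -
  have sym: "\<bar>bessel_sum p c 1 - bessel_sum p c' 1\<bar> \<le> 2 ^ p * \<bar>1 / c - 1 / c'\<bar>"
    if "c > 0" "c' > 0" for c c'
    using bessel_sum_lipschitz[OF assms, of c c'] bessel_sum_lipschitz[OF assms, of c' c] that
    by (cases c c' rule: linorder_cases) (auto simp: abs_minus_commute)
  have "(2 ^ p)-lipschitz_on {0<..} (\<lambda>v. bessel_sum p (1 / v) 1)"
    using sym[of "1 / _" "1 / _"] by (intro lipschitz_onI) (auto simp: dist_real_def)
  then have "continuous_on {0<..} (\<lambda>v. bessel_sum p (1 / v) 1)"
    by (rule lipschitz_on_continuous_on)
  then have "continuous_on {0<..} (\<lambda>c. bessel_sum p (1 / (1 / c)) 1)"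
    by (rule continuous_on_compose2) (auto intro!: continuous_intros)
  then show ?thesis by simp
qed

section \<open>Location of the two roots\<close>

text \<open>
  The terms shrink at least by a factor 4 from index 2 on, so the tail is at most \<open>4/3\<close> times the
  bound \<open>49 / (720 * 120 * 4\<^sup>6 * c)\<close> for the term of index 6, which is about \<open>1.85 / (10\<^sup>7 * c)\<close>.
  The smallest absolute value that has to be separated from 0 below is about \<open>6.3 / 10\<^sup>6\<close>.
\<close>

lemma bessel_sum_approx:
  assumes p: "p \<le> 2" and c: "c > 0"
  shows "\<bar>bessel_sum p c 1 - (\<Sum>n<6. real (Suc n) ^ p * bessel_coeff c n)\<bar> \<le> 2 / 10 ^ 7 / c"
proof -
  define t where "t = (\<lambda>n. real (Suc n) ^ p * bessel_coeff c n)"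
  have summ: "summable t"
    using summable_bessel_sum[OF p c, of 1] by (simp add: t_def)
  have step: "\<bar>t (Suc n)\<bar> \<le> \<bar>t n\<bar> / 4" if n: "n \<ge> 2" for n
  proof -
    have "real (Suc (Suc n)) ^ p \<le> (2 * real (Suc n)) ^ p"
      by (intro power_mono) auto
    also have "\<dots> = 2 ^ p * real (Suc n) ^ p" by (rule power_mult_distrib)
    also have "\<dots> \<le> 4 * real (Suc n) ^ p"
      using power_increasing[OF p, of "2::real"] by (intro mult_right_mono) auto
    finally have w: "real (Suc (Suc n)) ^ p \<le> 4 * real (Suc n) ^ p" .
    have "2 * 2 \<le> real (Suc n) * (c + real n)"
      using n c by (intro mult_mono) auto
    then have d: "4 * (2 * 2) \<le> 4 * real (Suc n) * (c + real n)"
      unfolding mult.assoc[of 4] by (rule mult_left_mono) simp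
    have "\<bar>t (Suc n)\<bar> = real (Suc (Suc n)) ^ p * (\<bar>bessel_coeff c n\<bar> / (4 * real (Suc n) * (c + real n)))"
      unfolding t_def bessel_coeff_Suc using c by (simp add: abs_mult del: of_nat_Suc)
    also have "\<dots> \<le> (4 * real (Suc n) ^ p) * (\<bar>bessel_coeff c n\<bar> / (4 * (2 * 2)))"
      using c n by (intro mult_mono w divide_left_mono d mult_pos_pos) auto
    also have "\<dots> = \<bar>t n\<bar> / 4"
      unfolding t_def by (simp add: abs_mult del: of_nat_Suc)
    finally show ?thesis .
  qed
  have bound: "\<bar>t (m + 6)\<bar> \<le> 49 / (720 * 120 * 4 ^ 6 * c) * (1 / 4) ^ m" for m
  proof (induction m)
    case 0
    have f: "fact 6 = (720 :: real)" "fact 5 = (120 :: real)" by (simp_all add: fact_numeral)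
    have "\<bar>t 6\<bar> = 7 ^ p / (4 ^ 6 * 720) * (1 / pochhammer c 6)"
      unfolding t_def bessel_coeff_def f using pochhammer_pos[OF c, of 6] by (simp add: abs_mult)
    also have "\<dots> \<le> 49 / (4 ^ 6 * 720) * ((1 / c) / 120)"
    proof (intro mult_mono divide_right_mono)
      show "7 ^ p \<le> (49 :: real)" using power_increasing[OF p, of "7::real"] by simp
      show "1 / pochhammer c 6 \<le> (1 / c) / 120"
        using inverse_pochhammer_le[OF c, of 5] unfolding f by (simp add: eval_nat_numeral)
    qed (use pochhammer_pos[OF c, of 6] in auto)
    finally show ?case by simp
  next
    case (Suc m)
    then show ?case using step[of "m + 6"] by simp
  qed
  have geo: "(\<lambda>m. 49 / (720 * 120 * 4 ^ 6 * c) * (1 / 4) ^ m) sums (49 / (720 * 120 * 4 ^ 6 * c) * (1 / (1 - 1 / 4)))"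
    by (intro sums_mult geometric_sums) simp
  have "\<bar>\<Sum>m. t (m + 6)\<bar> \<le> 49 / (720 * 120 * 4 ^ 6 * c) * (1 / (1 - 1 / 4))"
    using norm_suminf_le[OF _ sums_summable[OF geo], of "\<lambda>m. t (m + 6)"] bound sums_unique[OF geo] by simp
  also have "\<dots> \<le> 2 / 10 ^ 7 / c"
    using c by (simp add: divide_simps)
  finally have "\<bar>\<Sum>m. t (m + 6)\<bar> \<le> 2 / 10 ^ 7 / c" .
  moreover have "bessel_sum p c 1 = (\<Sum>m. t (m + 6)) + (\<Sum>n<6. t n)"
    using suminf_split_initial_segment[OF summ, of 6] by (simp add: bessel_sum_def t_def)
  ultimately show ?thesis by (simp add: t_def)
qed

lemma bessel_sum_numerics:
  shows "bessel_sum 1 (4376 / 10000) 1 < 0" and "bessel_sum 1 (4377 / 10000) 1 > 0"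
    and "bessel_sum 2 (8561 / 10000) 1 < 0" and "bessel_sum 2 (8562 / 10000) 1 > 0"
proof -
  define S where "S = (\<lambda>p c. \<Sum>n<6. real (Suc n) ^ p * bessel_coeff c n)"
  have upper: "bessel_sum p c 1 < 0" if "S p c + 2 / 10 ^ 7 / c < 0" "p \<le> 2" "c > 0" for p c
    using bessel_sum_approx[OF that(2,3)] that(1) unfolding S_def by linarith
  have lower: "bessel_sum p c 1 > 0" if "S p c - 2 / 10 ^ 7 / c > 0" "p \<le> 2" "c > 0" for p c
    using bessel_sum_approx[OF that(2,3)] that(1) unfolding S_def by linarith
  note expand = S_def eval_nat_numeral(2,3) lessThan_Suc bessel_coeff_Suc
  show "bessel_sum 1 (4376 / 10000) 1 < 0" by (rule upper) (simp_all add: expand)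
  show "bessel_sum 1 (4377 / 10000) 1 > 0" by (rule lower) (simp_all add: expand)
  show "bessel_sum 2 (8561 / 10000) 1 < 0" by (rule upper) (simp_all add: expand)
  show "bessel_sum 2 (8562 / 10000) 1 > 0" by (rule lower) (simp_all add: expand)
qed

lemma bessel_sum_root:
  assumes p: "p \<le> 2" and ab: "0 < a" "a < b" and sgn: "bessel_sum p a 1 < 0" "bessel_sum p b 1 > 0"
  obtains c0 where "a < c0" "c0 < b" "bessel_sum p c0 1 = 0"
    "\<And>c. c > 0 \<Longrightarrow> bessel_sum p c 1 = 0 \<longleftrightarrow> c = c0"
    "\<And>c. c > 0 \<Longrightarrow> bessel_sum p c 1 \<ge> 0 \<longleftrightarrow> c0 \<le> c"
proof -
  have "continuous_on {a..b} (\<lambda>c. bessel_sum p c 1)"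
    by (rule continuous_on_subset[OF continuous_on_bessel_sum[OF p]]) (use ab in auto)
  then obtain c0 where c0: "a \<le> c0" "c0 \<le> b" "bessel_sum p c0 1 = 0"
    using IVT'[of "\<lambda>c. bessel_sum p c 1" a 0 b] sgn ab by auto
  have mono: "bessel_sum p x 1 < bessel_sum p y 1" if "0 < x" "x < y" for x y
    by (rule bessel_sum_mono_c[OF p that])
  have "c0 > 0" using c0 ab by simp
  have tri: "bessel_sum p c 1 < 0 \<longleftrightarrow> c < c0" "bessel_sum p c 1 > 0 \<longleftrightarrow> c > c0" if "c > 0" for c
    using mono[OF that, of c0] mono[OF \<open>c0 > 0\<close>, of c] c0(3)
    by (cases c c0 rule: linorder_cases; simp)+
  show ?thesis
  proof (rule that[of c0])
    show "a < c0" "c0 < b" using c0 sgn by (auto simp: less_le)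
    show "bessel_sum p c 1 = 0 \<longleftrightarrow> c = c0" if "c > 0" for c
      using tri[OF that] c0(3) by (metis less_irrefl linorder_neqE)
    show "bessel_sum p c 1 \<ge> 0 \<longleftrightarrow> c0 \<le> c" if "c > 0" for c
      using tri(1)[OF that] by (simp only: not_less[symmetric])
  qed (fact c0(3))
qed

section \<open>The normalized Bessel function in the disk\<close>

lemma eval_fps_of_real:
  assumes "\<And>n. fps_nth F n = complex_of_real (a n)" and "summable (\<lambda>n. a n * x ^ n)"
  shows "eval_fps F (of_real x) = of_real (\<Sum>n. a n * x ^ n)"
  unfolding eval_fps_def assms(1) using suminf_of_real[OF assms(2), where 'a = complex] by simp

lemma eval_fps_cnj:
  assumes "\<And>n. fps_nth F n \<in> \<real>" and "fps_conv_radius F = \<infinity>"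
  shows "eval_fps F (cnj z) = cnj (eval_fps F z)"
proof -
  have "(\<lambda>n. cnj (fps_nth F n * z ^ n)) sums cnj (eval_fps F z)"
    unfolding sums_cnj using assms(2) by (intro sums_eval_fps) simp
  moreover have "cnj (fps_nth F n) = fps_nth F n" for n
    using assms(1) by (simp add: Reals_cnj_iff)
  ultimately show ?thesis by (simp add: eval_fps_def sums_iff)
qed

lemma convex_in_disk_uminus:
  assumes "convex_in_disk g"
  shows "convex_in_disk (\<lambda>z. - g z)"
proof -
  have "(\<lambda>z. - g z) ` ball 0 1 = uminus ` g ` ball 0 1" by auto
  then show ?thesis
    using assms unfolding convex_in_disk_def univalent_in_disk_def
    by (auto intro!: holomorphic_intros convex_negations simp: inj_on_def)
qed

context
  fixes c :: real and f :: "complex \<Rightarrow> complex"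
  assumes c: "c > 0"
  defines "f \<equiv> eval_fps (fps_X * bessel_fps c)"
begin

lemma bessel_coeffs_real:
  "fps_nth (fps_X * bessel_fps c) n \<in> \<real>" "fps_nth (fps_deriv (fps_X * bessel_fps c)) n \<in> \<real>"
  by auto

lemma holomorphic_bessel: "f holomorphic_on A"
  unfolding f_def using fps_conv_radius_X_bessel_fps[OF c] by (intro holomorphic_intros) simp

lemma fps_conv_radius_deriv_bessel:
  "fps_conv_radius (fps_deriv (fps_X * bessel_fps c)) = \<infinity>"
  "fps_conv_radius (fps_deriv (fps_deriv (fps_X * bessel_fps c))) = \<infinity>"
  by (intro fps_conv_radius_deriv_infinity fps_conv_radius_X_bessel_fps c)+

lemma deriv_bessel: "deriv f z = eval_fps (fps_deriv (fps_X * bessel_fps c)) z"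
  unfolding f_def using fps_conv_radius_X_bessel_fps[OF c] by (intro eval_fps_deriv[symmetric]) simp

lemma deriv2_bessel: "deriv (deriv f) z = eval_fps (fps_deriv (fps_deriv (fps_X * bessel_fps c))) z"
  unfolding deriv_bessel[abs_def]
  by (intro eval_fps_deriv[symmetric]) (unfold fps_conv_radius_deriv_bessel, simp)

lemma bessel_eq: "f z = z * eval_fps (bessel_fps c) z"
  unfolding f_def using c by (subst eval_fps_mult) simp_all

lemma deriv_bessel_eq: "deriv f z = eval_fps (bessel_fps c) z + z * eval_fps (fps_deriv (bessel_fps c)) z"
proof -
  have "fps_deriv (fps_X * bessel_fps c) = bessel_fps c + fps_X * fps_deriv (bessel_fps c)"
    by simp
  moreover have "fps_conv_radius (fps_X * fps_deriv (bessel_fps c)) = \<infinity>"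
    using fps_conv_radius_mult[of fps_X "fps_deriv (bessel_fps c)"] c by simp
  ultimately show ?thesis
    unfolding deriv_bessel using c by (simp only:) (simp add: eval_fps_add eval_fps_mult)
qed

lemma bessel_0 [simp]: "f 0 = 0" by (simp add: bessel_eq)

lemma bessel_cnj: "f (cnj z) = cnj (f z)"
  unfolding f_def by (rule eval_fps_cnj[OF bessel_coeffs_real(1) fps_conv_radius_X_bessel_fps[OF c]])

lemma deriv_bessel_cnj: "deriv f (cnj z) = cnj (deriv f z)"
  unfolding deriv_bessel by (intro eval_fps_cnj bessel_coeffs_real(2) fps_conv_radius_deriv_bessel)

lemma eval_bessel_fps_of_real:
  assumes "\<bar>x\<bar> \<le> 1"
  shows "eval_fps (bessel_fps c) (of_real x) = of_real (bessel_sum 0 c x)"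
  using summable_bessel_sum[of 0 c x] c assms
  by (subst eval_fps_of_real[where a = "bessel_coeff c"]) (auto simp: bessel_sum_def)

lemma deriv_bessel_of_real:
  assumes "\<bar>x\<bar> \<le> 1"
  shows "deriv f (of_real x) = of_real (bessel_sum 1 c x)"
  unfolding deriv_bessel bessel_sum_def using assms c
  by (intro eval_fps_of_real summable_bessel_sum) (auto simp: algebra_simps)

lemma deriv2_bessel_of_real:
  assumes "\<bar>x\<bar> \<le> 1"
  shows "deriv f (of_real x) + of_real x * deriv (deriv f) (of_real x) = of_real (bessel_sum 2 c x)"
proof -
  define G where "G = fps_deriv (fps_X * bessel_fps c)"
  have rad: "fps_conv_radius G = \<infinity>"
    unfolding G_def by (rule fps_conv_radius_deriv_bessel)
  then have rad': "fps_conv_radius (fps_X * fps_deriv G) = \<infinity>"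
    using fps_conv_radius_mult[of fps_X "fps_deriv G"] by simp
  have "fps_nth G n = of_nat (Suc n) * of_real (bessel_coeff c n)" for n
    unfolding G_def fps_deriv_nth by simp
  then have "fps_nth (fps_deriv (fps_X * G)) n = of_real (real (Suc n) ^ 2 * bessel_coeff c n)" for n
    unfolding fps_deriv_nth by (simp add: power2_eq_square del: of_nat_Suc)
  then have "eval_fps (fps_deriv (fps_X * G)) (of_real x) = of_real (bessel_sum 2 c x)"
    unfolding bessel_sum_def using assms c
    by (intro eval_fps_of_real summable_bessel_sum) auto
  moreover have "fps_deriv (fps_X * G) = G + fps_X * fps_deriv G" by simp
  ultimately show ?thesis
    unfolding deriv_bessel deriv2_bessel G_def[symmetric] using rad rad'
    by (simp only:) (simp add: eval_fps_add eval_fps_mult)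
qed

text \<open>
  Minus the derivative of \<open>f\<close> is a convex map with real coefficients and positive derivative
  \<open>1 / (2 c)\<close> at the origin, so its real part on each circle is largest on the positive axis.
\<close>

lemma Re_deriv_bessel_ge:
  assumes z: "z \<in> ball 0 1"
  shows "Re (deriv f z) \<ge> bessel_sum 1 c (norm z)"
proof -
  have f': "deriv f = eval_fps ((fps_deriv ^^ 1) (fps_X * bessel_fps c))"
    by (auto simp: deriv_bessel)
  have conv: "convex_in_disk (\<lambda>z. - deriv f z)"
    unfolding f' by (intro convex_in_disk_uminus bessel_higher_derivatives_convex c) simp
  have "deriv f holomorphic_on UNIV"
    by (intro holomorphic_deriv holomorphic_bessel) simp
  then have "deriv (\<lambda>z. - deriv f z) 0 = - deriv (deriv f) 0"
    by (intro deriv_minus holomorphic_on_imp_differentiable_at[of _ UNIV]) auto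
  also have "\<dots> = of_real (1 / (2 * c))"
    unfolding deriv2_bessel by (simp add: eval_fps_at_0 bessel_coeff_def)
  finally have pos: "Re (deriv (\<lambda>z. - deriv f z) 0) > 0" using c by (simp del: of_real_divide)
  have "Re (- deriv f z) \<le> Re (- deriv f (of_real (norm z)))"
    by (rule convex_symmetric_Re_le[OF conv _ pos z]) (simp add: deriv_bessel_cnj)
  then show ?thesis using deriv_bessel_of_real[of "norm z"] z by simp
qed

lemma Re_deriv_bessel_pos:
  assumes "bessel_sum 1 c 1 \<ge> 0" and z: "z \<in> ball 0 1"
  shows "Re (deriv f z) > 0"
proof -
  have "bessel_sum 1 c 1 < bessel_sum 1 c (norm z)"
    using z by (intro bessel_sum_antimono_x c) auto
  then show ?thesis using Re_deriv_bessel_ge[OF z] assms(1) by linarith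
qed

lemma bessel_univalent:
  assumes "bessel_sum 1 c 1 \<ge> 0"
  shows "inj_on f (ball 0 1)"
  using Re_deriv_bessel_pos[OF assms]
  by (intro inj_on_if_Re_deriv_pos[of _ _ 1] holomorphic_bessel) auto

text \<open>
  With \<open>f = z B\<close> one has \<open>z f' / f = 1 + z B' / B\<close>. The real part of the right-hand side is at least
  its value at \<open>r = norm z\<close>, which is \<open>f'(r) / B(r)\<close>, and \<open>f'(r) > f'(1) \<ge> 0\<close>.
\<close>

lemma bessel_starlike:
  assumes ge: "bessel_sum 1 c 1 \<ge> 0"
  shows "starlike_in_disk f"
proof (rule starlike_in_disk_if_Re_nonneg[OF holomorphic_bessel bessel_univalent[OF ge] bessel_0])
  have nz: "eval_fps (bessel_fps c) z \<noteq> 0" if "z \<in> ball 0 1" for z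
  proof (cases "z = 0")
    case False
    then have "f z \<noteq> f 0"
      using inj_onD[OF bessel_univalent[OF ge], of z 0] that by auto
    then show ?thesis by (auto simp: bessel_eq)
  qed (simp add: eval_fps_at_0)
  have pos: "bessel_sum 0 c r > 0" if r: "0 \<le> r" "r < 1" for r
  proof (rule pos_if_continuous_nonzero[of 0 r])
    have "continuous_on {0..r} (\<lambda>x. Re (eval_fps (bessel_fps c) (of_real x)))"
      using c by (intro continuous_intros continuous_on_eval_fps') auto
    then show "continuous_on {0..r} (bessel_sum 0 c)"
      by (rule continuous_on_eq) (use r in \<open>auto simp: eval_bessel_fps_of_real\<close>)
    show "bessel_sum 0 c 0 > 0" using eval_bessel_fps_of_real[of 0] by (simp add: eval_fps_at_0)
    show "bessel_sum 0 c x \<noteq> 0" if "x \<in> {0..r}" for x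
      using nz[of "of_real x"] eval_bessel_fps_of_real[of x] that r by auto
  qed (use r in simp)
  fix z :: complex assume z: "z \<in> ball 0 1" "z \<noteq> 0"
  define q where "q = (\<lambda>z. z * eval_fps (fps_deriv (bessel_fps c)) z / eval_fps (bessel_fps c) z)"
  have q: "deriv f w / eval_fps (bessel_fps c) w = 1 + q w" if "w \<in> ball 0 1" for w
    using nz[OF that] by (simp add: deriv_bessel_eq q_def add_divide_distrib)
  let ?r = "complex_of_real (norm z)"
  have "1 + q ?r = of_real (bessel_sum 1 c (norm z)) / of_real (bessel_sum 0 c (norm z))"
    using q[of ?r] z deriv_bessel_of_real[of "norm z"] eval_bessel_fps_of_real[of "norm z"] by simp
  then have "Re (1 + q ?r) = bessel_sum 1 c (norm z) / bessel_sum 0 c (norm z)"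
    by (simp only: of_real_divide[symmetric] Re_complex_of_real)
  moreover have "bessel_sum 1 c 1 < bessel_sum 1 c (norm z)"
    using z by (intro bessel_sum_antimono_x c) auto
  ultimately have "Re (1 + q ?r) \<ge> 0"
    using ge pos[of "norm z"] z by simp
  moreover have "Re (q z) \<ge> Re (q ?r)"
    unfolding q_def using c z nz nonneg_coeffs_bessel_log_deriv[OF c]
    by (intro Re_log_deriv_ge) auto
  moreover have "z * deriv f z / f z = 1 + q z"
    using z q[of z] by (simp add: bessel_eq)
  ultimately show "Re (z * deriv f z / f z) \<ge> 0" by simp
qed

text \<open>
  As for starlikeness, \<open>Re (1 + z f'' / f')\<close> is at least its value at \<open>r = norm z\<close>, which is
  \<open>(z f')'(r) / f'(r)\<close>.
\<close>

lemma bessel_convex: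
  assumes ge: "bessel_sum 1 c 1 \<ge> 0" "bessel_sum 2 c 1 \<ge> 0"
  shows "convex_in_disk f"
proof (rule convex_in_disk_if_Re_nonneg[OF holomorphic_bessel bessel_univalent[OF ge(1)]])
  fix z :: complex assume z: "z \<in> ball 0 1"
  define q where "q = (\<lambda>z. z * deriv (deriv f) z / deriv f z)"
  let ?r = "complex_of_real (norm z)"
  have nz: "deriv f w \<noteq> 0" if "w \<in> ball 0 1" for w
    using Re_deriv_bessel_pos[OF ge(1) that] by auto
  have S: "bessel_sum 1 c (norm z) > 0" "bessel_sum 2 c (norm z) > 0"
    using bessel_sum_antimono_x[of 1 c "norm z" 1] bessel_sum_antimono_x[of 2 c "norm z" 1] ge c z
    by auto
  have "1 + q ?r = (deriv f ?r + ?r * deriv (deriv f) ?r) / deriv f ?r"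
    using nz[of ?r] z by (simp add: q_def add_divide_distrib)
  also have "\<dots> = of_real (bessel_sum 2 c (norm z) / bessel_sum 1 c (norm z))"
    using z deriv_bessel_of_real[of "norm z"] deriv2_bessel_of_real[of "norm z"] by simp
  finally have "Re (1 + q ?r) = bessel_sum 2 c (norm z) / bessel_sum 1 c (norm z)"
    by (simp only: Re_complex_of_real)
  then have "Re (1 + q ?r) \<ge> 0" using S by simp
  moreover have "Re (q z) \<ge> Re (q ?r)"
    unfolding q_def deriv2_bessel unfolding deriv_bessel
  proof (rule Re_log_deriv_ge)
    show "fps_conv_radius (fps_deriv (fps_X * bessel_fps c)) = \<infinity>"
      by (rule fps_conv_radius_deriv_bessel)
    show "eval_fps (fps_deriv (fps_X * bessel_fps c)) w \<noteq> 0" if "w \<in> ball 0 1" for w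
      using nz[OF that] unfolding deriv_bessel .
    show "nonneg_coeffs (- fps_deriv (fps_deriv (fps_X * bessel_fps c)) * inverse (fps_deriv (fps_X * bessel_fps c)))"
      by (rule nonneg_coeffs_bessel_deriv_log_deriv[OF c])
  qed (use z in simp_all)
  ultimately show "Re (1 + z * deriv (deriv f) z / deriv f z) \<ge> 0"
    by (simp add: q_def)
qed

text \<open>
  The necessary conditions are obtained inside the disk; they pass to the boundary point 1
  because the functions are entire. Here \<open>h\<close> stands for the entire function that
  \<open>bessel_sum p c\<close> is the restriction of.
\<close>

lemma bessel_sum_nonneg_at_1:
  assumes "\<And>r. 0 < r \<Longrightarrow> r < 1 \<Longrightarrow> bessel_sum p c r \<ge> 0" and cont: "((\<lambda>r. h (of_real r)) \<longlongrightarrow> (h 1 :: complex)) (at_left (1::real))"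
    and h: "\<And>r. \<bar>r\<bar> \<le> 1 \<Longrightarrow> h (of_real r) = of_real (bessel_sum p c r)"
  shows "bessel_sum p c 1 \<ge> 0"
proof -
  have lim: "((\<lambda>r. Re (h (of_real r))) \<longlongrightarrow> Re (h 1)) (at_left (1::real))"
    by (intro tendsto_intros cont)
  have "eventually (\<lambda>r::real. r \<in> {0<..<1}) (at_left 1)"
    by (rule eventually_at_left_real) simp
  then have "eventually (\<lambda>r. Re (h (of_real r)) \<ge> 0) (at_left 1)"
    by eventually_elim (use assms(1) h in auto)
  then have "Re (h 1) \<ge> 0"
    using lim by (intro tendsto_lowerbound[OF lim]) simp_all
  then show ?thesis using h[of 1] by simp
qed

lemma isCont_at_left_of_real:
  fixes h :: "complex \<Rightarrow> complex"
  assumes "isCont h 1"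
  shows "((\<lambda>r. h (of_real r)) \<longlongrightarrow> h 1) (at_left (1::real))"
proof -
  have "((\<lambda>r. complex_of_real r) \<longlongrightarrow> of_real 1) (at_left 1)"
    by (intro tendsto_intros)
  then show ?thesis using isCont_tendsto_compose[OF assms] by simp
qed

lemma isCont_deriv_bessel: "isCont (deriv f) z" "isCont (deriv (deriv f)) z"
proof -
  have "deriv f holomorphic_on UNIV" "deriv (deriv f) holomorphic_on UNIV"
    by (intro holomorphic_deriv holomorphic_bessel open_UNIV)+
  then show "isCont (deriv f) z" "isCont (deriv (deriv f)) z"
    by (auto dest!: holomorphic_on_imp_continuous_on simp: continuous_on_eq_continuous_at)
qed

lemma Re_deriv_bessel_0: "Re (deriv f 0) > 0"
  by (simp add: deriv_bessel eval_fps_at_0)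

lemma starlike_imp_bessel_sum_nonneg:
  assumes "starlike_in_disk f"
  shows "bessel_sum 1 c 1 \<ge> 0"
proof (rule bessel_sum_nonneg_at_1[where h = "deriv f"])
  fix r :: real assume "0 < r" "r < 1"
  then have "Re (deriv f (of_real r)) > 0"
    using assms Re_deriv_bessel_0 by (intro univalent_symmetric_deriv_pos)
      (auto simp: starlike_in_disk_def bessel_cnj)
  then show "bessel_sum 1 c r \<ge> 0" using deriv_bessel_of_real[of r] \<open>0 < r\<close> \<open>r < 1\<close> by simp
qed (fact isCont_at_left_of_real[OF isCont_deriv_bessel(1)], fact deriv_bessel_of_real)

lemma convex_imp_bessel_sum_nonneg:
  assumes "convex_in_disk f"
  shows "bessel_sum 2 c 1 \<ge> 0"
proof (rule bessel_sum_nonneg_at_1[where h = "\<lambda>z. deriv f z + z * deriv (deriv f) z"])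
  fix r :: real assume r: "0 < r" "r < 1"
  have "Re (deriv f (of_real r) + of_real r * deriv (deriv f) (of_real r)) \<ge> 0"
    using r by (intro convex_symmetric_imp_nonneg[OF assms] Re_deriv_bessel_0) (simp_all add: bessel_cnj)
  then show "bessel_sum 2 c r \<ge> 0" using deriv2_bessel_of_real[of r] r by simp
next
  show "((\<lambda>r. deriv f (of_real r) + of_real r * deriv (deriv f) (of_real r)) \<longlongrightarrow> deriv f 1 + 1 * deriv (deriv f) 1) (at_left (1::real))"
    by (rule isCont_at_left_of_real) (intro continuous_intros isCont_deriv_bessel)
qed (rule deriv2_bessel_of_real)

end

section \<open>The equation for the convexity threshold\<close>

text \<open>
  This is the value at 1 of Bessel's equation \<open>z B'' + c B' + B / 4 = 0\<close>, used to remove \<open>B''\<close> from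
  \<open>(z f')' = B + 3 z B' + z\<^sup>2 B''\<close>, together with \<open>B'\<^sub>c = - B\<^bsub>c+1\<^esub> / (4 c)\<close>.
\<close>

lemma bessel_sum_equation:
  assumes c: "c > 0"
  shows "3 * bessel_sum 0 c 1 + (c - 3) / c * bessel_sum 0 (c + 1) 1 = 4 * bessel_sum 2 c 1"
proof -
  define a where "a = bessel_coeff c"
  have s0: "a sums bessel_sum 0 c 1"
    using summable_bessel_sum[of 0 c 1] c by (simp add: bessel_sum_def a_def sums_iff)
  have s1: "(\<lambda>n. (real n + 1) * a n) sums bessel_sum 1 c 1"
    using summable_bessel_sum[of 1 c 1] c by (simp add: bessel_sum_def a_def sums_iff add.commute)
  have s2: "(\<lambda>n. (real n + 1)\<^sup>2 * a n) sums bessel_sum 2 c 1"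
    using summable_bessel_sum[of 2 c 1] c by (simp add: bessel_sum_def a_def sums_iff add.commute)
  have t0: "bessel_coeff (c + 1) sums bessel_sum 0 (c + 1) 1"
    using summable_bessel_sum[of 0 "c + 1" 1] c by (simp add: bessel_sum_def sums_iff)
  have rec: "real (Suc n) * a (Suc n) = - bessel_coeff (c + 1) n / (4 * c)" for n
    by (simp add: a_def bessel_coeff_def pochhammer_rec[of c n] mult_ac del: of_nat_Suc)
  have "(\<lambda>n. real (Suc n) * a (Suc n)) sums (- bessel_sum 0 (c + 1) 1 / (4 * c))"
    unfolding rec by (intro sums_divide sums_minus t0)
  then have n1: "(\<lambda>n. real n * a n) sums (- bessel_sum 0 (c + 1) 1 / (4 * c))"
    by (subst (asm) sums_Suc_iff) simp
  have "(\<lambda>n. (real n + 1) * a n - a n) sums (bessel_sum 1 c 1 - bessel_sum 0 c 1)"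
    by (intro sums_diff s0 s1)
  then have "(\<lambda>n. real n * a n) sums (bessel_sum 1 c 1 - bessel_sum 0 c 1)"
    by (simp add: algebra_simps)
  with n1 have e1: "bessel_sum 1 c 1 - bessel_sum 0 c 1 = - bessel_sum 0 (c + 1) 1 / (4 * c)"
    by (rule sums_unique2[rotated])
  have rec2: "4 * real (Suc n) * (real n + c) * a (Suc n) = - a n" for n
    unfolding a_def bessel_coeff_Suc using c by (simp add: add.commute del: of_nat_Suc)
  have "(\<lambda>n. 4 * real (Suc n) * (real n + c) * a (Suc n)) sums (- bessel_sum 0 c 1)"
    unfolding rec2 by (intro sums_minus s0)
  then have "(\<lambda>n. 4 * real (Suc n) * (real (Suc n) - 1 + c) * a (Suc n)) sums (- bessel_sum 0 c 1)"
    by (simp add: add.commute)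
  then have n2: "(\<lambda>n. 4 * real n * (real n - 1 + c) * a n) sums (- bessel_sum 0 c 1)"
    using sums_Suc_iff[of "\<lambda>n. 4 * real n * (real n - 1 + c) * a n"] by simp
  have "(\<lambda>n. 4 * ((real n + 1)\<^sup>2 * a n) + (4 * c - 12) * ((real n + 1) * a n) + (8 - 4 * c) * a n)
      sums (4 * bessel_sum 2 c 1 + (4 * c - 12) * bessel_sum 1 c 1 + (8 - 4 * c) * bessel_sum 0 c 1)"
    by (intro sums_add sums_mult s0 s1 s2)
  then have "(\<lambda>n. 4 * real n * (real n - 1 + c) * a n)
      sums (4 * bessel_sum 2 c 1 + (4 * c - 12) * bessel_sum 1 c 1 + (8 - 4 * c) * bessel_sum 0 c 1)"
    by (simp add: algebra_simps power2_eq_square)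
  from sums_unique2[OF this n2]
  have e2: "4 * bessel_sum 2 c 1 = (12 - 4 * c) * (bessel_sum 1 c 1 - bessel_sum 0 c 1) + 3 * bessel_sum 0 c 1"
    by (simp add: algebra_simps)
  show ?thesis unfolding e2 e1 using c by (simp add: divide_simps) (simp add: algebra_simps)
qed

lemma Bessel_J_at_1:
  assumes "\<nu> > -1"
  shows "Bessel_J \<nu> 1 = (1 / 2) powr of_real \<nu> / Gamma (of_real (\<nu> + 1)) * of_real (bessel_sum 0 (\<nu> + 1) 1)"
proof -
  let ?c = "\<nu> + 1" and ?K = "(1 / 2) powr of_real \<nu> / Gamma (of_real (\<nu> + 1)) :: complex"
  have c: "?c > 0" using assms by simp
  have G: "Gamma (complex_of_real ?c) \<noteq> 0"
    using c by (subst Gamma_complex_of_real) (simp add: Gamma_real_pos less_imp_neq[symmetric])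
  have "(-1) ^ n / (fact n * Gamma (of_real \<nu> + of_nat n + 1)) * (1 / 2) powr (of_nat (2 * n) + of_real \<nu>)
      = ?K * of_real (bessel_coeff ?c n)" for n
  proof -
    have "(1 / 2 :: complex) powr (of_nat (2 * n) + of_real \<nu>) = (1 / 2) powr of_real \<nu> / 4 ^ n"
      by (simp only: powr_add powr_nat) (simp add: power_mult power_divide)
    moreover have "of_real \<nu> + of_nat n + 1 = of_real ?c + (of_nat n :: complex)" by simp
    ultimately show ?thesis
      unfolding bessel_coeff_Gamma[OF c] using G by (simp only:) (simp add: mult_ac)
  qed
  then have "Bessel_J \<nu> 1 = (\<Sum>n. ?K * of_real (bessel_coeff ?c n))"
    by (simp only: Bessel_J_def) simp
  also have "\<dots> = ?K * (\<Sum>n. of_real (bessel_coeff ?c n))"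
    using bessel_series_summable[OF c, of 1] by (intro suminf_mult) simp
  also have "(\<Sum>n. of_real (bessel_coeff ?c n)) = complex_of_real (bessel_sum 0 ?c 1)"
    unfolding bessel_sum_def using summable_bessel_sum[OF _ c, of 0 1]
    by (subst suminf_of_real) simp_all
  finally show ?thesis .
qed

lemma Bessel_J_equation_iff:
  assumes "\<nu> > -1"
  shows "3 * Bessel_J \<nu> 1 + 2 * (of_real \<nu> - 2) * Bessel_J (\<nu> + 1) 1 = 0 \<longleftrightarrow> bessel_sum 2 (\<nu> + 1) 1 = 0"
proof -
  define c where "c = \<nu> + 1"
  have c: "c > 0" using assms by (simp add: c_def)
  define K :: complex where "K = (1 / 2) powr of_real \<nu> / Gamma (of_real c)"
  have c': "complex_of_real c \<notin> \<int>\<^sub>\<le>\<^sub>0"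
    using c by (auto elim!: nonpos_Ints_cases simp: complex_eq_iff)
  have K: "K \<noteq> 0" using c' by (simp add: K_def Gamma_eq_zero_iff)
  have J0: "Bessel_J \<nu> 1 = K * of_real (bessel_sum 0 c 1)"
    using Bessel_J_at_1[OF assms] by (simp add: K_def c_def)
  have G: "Gamma (complex_of_real (c + 1)) = of_real c * Gamma (of_real c)"
    using Gamma_plus1[OF c'] by simp
  have pw: "(1 / 2 :: complex) powr of_real c = (1 / 2) powr of_real \<nu> / 2"
    unfolding c_def by (simp add: powr_add)
  have J1: "Bessel_J c 1 = K / (2 * of_real c) * of_real (bessel_sum 0 (c + 1) 1)"
  proof -
    have "Bessel_J c 1 = (1 / 2) powr of_real c / Gamma (of_real (c + 1)) * of_real (bessel_sum 0 (c + 1) 1)"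
      using c by (intro Bessel_J_at_1) simp
    then show ?thesis unfolding G pw K_def by simp
  qed
  have "3 * Bessel_J \<nu> 1 + 2 * (of_real \<nu> - 2) * Bessel_J (\<nu> + 1) 1
      = K * of_real (3 * bessel_sum 0 c 1 + (c - 3) / c * bessel_sum 0 (c + 1) 1)"
  proof -
    have "2 * (of_real \<nu> - 2) * (K / (2 * of_real c) * S) = K * (of_real ((c - 3) / c) * S)" for S
    proof -
      have "of_real \<nu> - 2 = complex_of_real (c - 3)" by (simp add: c_def)
      moreover have "2 * a * (K / (2 * of_real c) * S) = K * (a / of_real c * S)" for a by simp
      ultimately show ?thesis by (simp only: of_real_divide)
    qed
    then show ?thesis unfolding J0 c_def[symmetric] J1 by (simp only: of_real_add of_real_mult) (simp add: algebra_simps)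
  qed
  also have "\<dots> = K * of_real (4 * bessel_sum 2 c 1)"
    by (simp only: bessel_sum_equation[OF c])
  finally show ?thesis using K by (simp add: c_def)
qed

section \<open>The two thresholds\<close>

theorem theorem1:
  shows
    "(\<exists>\<nu>0::real.
        \<nu>0 > -1 \<and> deriv (normalized_Bessel \<nu>0) 1 = 0 \<and>
        (\<forall>\<nu>::real. \<nu> > -1 \<and> deriv (normalized_Bessel \<nu>) 1 = 0 \<longrightarrow> \<nu> = \<nu>0) \<and>
        -0.5624 < \<nu>0 \<and> \<nu>0 \<le> -0.5623 \<and>
        (\<forall>\<nu>::real. \<nu> > -1 \<longrightarrow>
           (starlike_in_disk (normalized_Bessel \<nu>) \<and>
            (\<forall>k\<ge>1. close_to_convex_in_disk ((deriv ^^ k) (normalized_Bessel \<nu>)))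
            \<longleftrightarrow> \<nu> \<ge> \<nu>0)))
     \<and>
     (\<exists>\<nu>1::real.
        \<nu>1 > -1 \<and> 3 * Bessel_J \<nu>1 1 + 2 * (of_real \<nu>1 - 2) * Bessel_J (\<nu>1 + 1) 1 = 0 \<and>
        (\<forall>\<nu>::real. \<nu> > -1 \<and> 3 * Bessel_J \<nu> 1 + 2 * (of_real \<nu> - 2) * Bessel_J (\<nu> + 1) 1 = 0
           \<longrightarrow> \<nu> = \<nu>1) \<and>
        -0.1439 < \<nu>1 \<and> \<nu>1 \<le> -0.1438 \<and>
        (\<forall>\<nu>::real. \<nu> > -1 \<longrightarrow>
           (convex_in_disk (normalized_Bessel \<nu>) \<and>
            (\<forall>k\<ge>1. convex_in_disk ((deriv ^^ k) (normalized_Bessel \<nu>)))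
            \<longleftrightarrow> \<nu> \<ge> \<nu>1)))"
proof -
  obtain c0 where c0: "4376 / 10000 < c0" "c0 < 4377 / 10000" "bessel_sum 1 c0 1 = 0"
      and c0_root: "\<And>c. c > 0 \<Longrightarrow> bessel_sum 1 c 1 = 0 \<longleftrightarrow> c = c0"
      and c0_ge: "\<And>c. c > 0 \<Longrightarrow> bessel_sum 1 c 1 \<ge> 0 \<longleftrightarrow> c0 \<le> c"
    by (rule bessel_sum_root[OF _ _ _ bessel_sum_numerics(1,2)]) auto
  obtain c1 where c1: "8561 / 10000 < c1" "c1 < 8562 / 10000" "bessel_sum 2 c1 1 = 0"
      and c1_root: "\<And>c. c > 0 \<Longrightarrow> bessel_sum 2 c 1 = 0 \<longleftrightarrow> c = c1"
      and c1_ge: "\<And>c. c > 0 \<Longrightarrow> bessel_sum 2 c 1 \<ge> 0 \<longleftrightarrow> c1 \<le> c"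
    by (rule bessel_sum_root[OF _ _ _ bessel_sum_numerics(3,4)]) auto
  have f: "normalized_Bessel \<nu> = eval_fps (fps_X * bessel_fps (\<nu> + 1))" "\<nu> + 1 > 0" if "\<nu> > -1" for \<nu>
    using normalized_Bessel_eq_eval_fps[OF that] that by auto
  have deriv1: "deriv (normalized_Bessel \<nu>) 1 = of_real (bessel_sum 1 (\<nu> + 1) 1)" if "\<nu> > -1" for \<nu>
    using deriv_bessel_of_real[OF f(2)[OF that], of 1] by (simp add: f[OF that])
  have higher: "convex_in_disk ((deriv ^^ k) (normalized_Bessel \<nu>))" if "\<nu> > -1" "k \<ge> 1" for \<nu> k
    unfolding f[OF that(1)] funpow_deriv_eval_fps[OF fps_conv_radius_X_bessel_fps[OF f(2)[OF that(1)]]]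
    by (rule bessel_higher_derivatives_convex[OF f(2)[OF that(1)] that(2)])
  have star: "starlike_in_disk (normalized_Bessel \<nu>) \<longleftrightarrow> c0 \<le> \<nu> + 1" if "\<nu> > -1" for \<nu>
    unfolding c0_ge[OF f(2)[OF that], symmetric] f(1)[OF that]
    using bessel_starlike[OF f(2)[OF that]] starlike_imp_bessel_sum_nonneg[OF f(2)[OF that]] by blast
  have conv: "convex_in_disk (normalized_Bessel \<nu>) \<longleftrightarrow> c1 \<le> \<nu> + 1" if "\<nu> > -1" for \<nu>
  proof
    assume "convex_in_disk (normalized_Bessel \<nu>)"
    then show "c1 \<le> \<nu> + 1"
      unfolding c1_ge[OF f(2)[OF that], symmetric] f(1)[OF that]
      by (rule convex_imp_bessel_sum_nonneg[OF f(2)[OF that]])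
  next
    assume le: "c1 \<le> \<nu> + 1"
    then have "bessel_sum 1 (\<nu> + 1) 1 \<ge> 0" "bessel_sum 2 (\<nu> + 1) 1 \<ge> 0"
      unfolding c1_ge[OF f(2)[OF that]] c0_ge[OF f(2)[OF that]] using c0 c1 by auto
    then show "convex_in_disk (normalized_Bessel \<nu>)"
      unfolding f(1)[OF that] by (rule bessel_convex[OF f(2)[OF that]])
  qed
  have a: "c0 - 1 > -1 \<and> deriv (normalized_Bessel (c0 - 1)) 1 = 0 \<and>
        (\<forall>\<nu>::real. \<nu> > -1 \<and> deriv (normalized_Bessel \<nu>) 1 = 0 \<longrightarrow> \<nu> = c0 - 1) \<and>
        -0.5624 < c0 - 1 \<and> c0 - 1 \<le> -0.5623 \<and>
        (\<forall>\<nu>::real. \<nu> > -1 \<longrightarrow>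
           (starlike_in_disk (normalized_Bessel \<nu>) \<and>
            (\<forall>k\<ge>1. close_to_convex_in_disk ((deriv ^^ k) (normalized_Bessel \<nu>)))
            \<longleftrightarrow> \<nu> \<ge> c0 - 1))"
  proof (intro conjI allI impI)
    show "deriv (normalized_Bessel (c0 - 1)) 1 = 0"
      using c0 by (subst deriv1) auto
    show "\<nu> = c0 - 1" if "\<nu> > -1 \<and> deriv (normalized_Bessel \<nu>) 1 = 0" for \<nu>
      using that deriv1[of \<nu>] c0_root[of "\<nu> + 1"] by simp
    show "starlike_in_disk (normalized_Bessel \<nu>) \<and>
        (\<forall>k\<ge>1. close_to_convex_in_disk ((deriv ^^ k) (normalized_Bessel \<nu>)))
        \<longleftrightarrow> \<nu> \<ge> c0 - 1" if "\<nu> > -1" for \<nu>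
      using star[OF that] higher[OF that] close_to_convex_if_convex by auto
  qed (use c0 in simp_all)
  have b: "c1 - 1 > -1 \<and> 3 * Bessel_J (c1 - 1) 1 + 2 * (of_real (c1 - 1) - 2) * Bessel_J (c1 - 1 + 1) 1 = 0 \<and>
        (\<forall>\<nu>::real. \<nu> > -1 \<and> 3 * Bessel_J \<nu> 1 + 2 * (of_real \<nu> - 2) * Bessel_J (\<nu> + 1) 1 = 0
           \<longrightarrow> \<nu> = c1 - 1) \<and>
        -0.1439 < c1 - 1 \<and> c1 - 1 \<le> -0.1438 \<and>
        (\<forall>\<nu>::real. \<nu> > -1 \<longrightarrow>
           (convex_in_disk (normalized_Bessel \<nu>) \<and>
            (\<forall>k\<ge>1. convex_in_disk ((deriv ^^ k) (normalized_Bessel \<nu>)))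
            \<longleftrightarrow> \<nu> \<ge> c1 - 1))"
  proof (intro conjI allI impI)
    show "3 * Bessel_J (c1 - 1) 1 + 2 * (of_real (c1 - 1) - 2) * Bessel_J (c1 - 1 + 1) 1 = 0"
      using c1 by (subst Bessel_J_equation_iff) auto
    show "\<nu> = c1 - 1" if "\<nu> > -1 \<and> 3 * Bessel_J \<nu> 1 + 2 * (of_real \<nu> - 2) * Bessel_J (\<nu> + 1) 1 = 0" for \<nu>
    proof -
      have "bessel_sum 2 (\<nu> + 1) 1 = 0" using that Bessel_J_equation_iff by blast
      then show ?thesis using that c1_root[of "\<nu> + 1"] by simp
    qed
    show "convex_in_disk (normalized_Bessel \<nu>) \<and>
        (\<forall>k\<ge>1. convex_in_disk ((deriv ^^ k) (normalized_Bessel \<nu>)))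
        \<longleftrightarrow> \<nu> \<ge> c1 - 1" if "\<nu> > -1" for \<nu>
      using conv[OF that] higher[OF that] by auto
  qed (use c1 in simp_all)
  show ?thesis
    by (rule conjI, rule exI[where x = "c0 - 1"], rule a, rule exI[where x = "c1 - 1"], rule b)
qed

end
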